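(* Let $\widehat\beta$ be any first-step estimator (any data-dependent vector in $\mathbb R^p$) acting as the model selector, let $\widehat T:=\operatorname{support}(\widehat\beta)$ be the model it selects, and suppose $|\widehat T|\le n$. Let $\widetilde\beta$ be the post-model selection estimator $$\widetilde\beta\in\arg\min_{\beta\in\mathbb R^p}\widehat Q(\beta):\ \beta_j=0\ \text{ for each } j\in\widehat T^c .$$ Let $B_n:=\widehat Q(\widehat\beta)-\widehat Q(\beta_0)$, $C_n:=\widehat Q(\beta_{0\widehat T})-\widehat Q(\beta_0)$, let $\widehat m=|\widehat T\setminus T|$ be the number of incorrect regressors selected, and let $\widehat k=|T\setminus\widehat T|$. Suppose $\widetilde\kappa(\widehat m)>0$. Then for any $\varepsilon>0$ there is a constant $K_\varepsilon$ independent of $n$ such that with probability at least $1-\varepsilon$, for $\widetilde f_i=x_i'\widetilde\beta$, $$\|\widetilde f-f\|_{\mathbb P_n,2}\le K_\varepsilon\sigma\sqrt{\frac{\widehat m\log p+(\widehat m+s)\log(\mathrm e\,\mu(\widehat m))}{n}}+3c_s+\sqrt{(B_n)_+\wedge(C_n)_+}.$$ Furthermore, for any $\varepsilon>0$ there is a constant $K_\varepsilon$ independent of $n$ such that with probability at least $1-\varepsilon$, $$B_n\le\|\widehat\beta-\beta_0\|_{2,n}^2+\Bigg[K_\varepsilon\sigma\sqrt{\frac{\widehat m\log p+(\widehat m+s)\log(\mathrm e\,\mu(\widehat m))}{n}}+2c_s\Bigg]\|\widehat\beta-\beta_0\|_{2,n},$$ $$C_n\le 1\{T\not\subseteq\widehat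 T\}\Bigg(\|\beta_{0\widehat T^c}\|_{2,n}^2+\Bigg[K_\varepsilon\sigma\sqrt{\frac{\log\binom{s}{\widehat k}+\widehat k\log(\mathrm e\,\mu(0))}{n}}+2c_s\Bigg]\|\beta_{0\widehat T^c}\|_{2,n}\Bigg).$$
   Context: Setting. For each $n$ the data satisfy $y_i=f_i+\epsilon_i$, $f_i=f(z_i)$, $i=1,\dots,n$, with $\epsilon_i$ i.i.d. $N(0,\sigma^2)$, $\sigma>0$, and fixed (nonrandom) $z_i$. The vectors $x_i=P(z_i)\in\mathbb R^p$ are fixed technical regressors ($p$ may exceed $n$) normalized so that $\mathbb E_n[x_{\bullet j}^2]=1$ for $j=1,\dots,p$, where $\mathbb E_n[g_\bullet]=\frac1n\sum_{i=1}^n g_i$. Write $\widehat Q(\beta)=\mathbb E_n[(y_\bullet-x_\bullet'\beta)^2]$, $\|\delta\|_{2,n}=(\mathbb E_n[(x_\bullet'\delta)^2])^{1/2}$ and $\|g\|_{\mathbb P_n,2}=(\mathbb E_n[g_\bullet^2])^{1/2}$; $\|\cdot\|$ is the $\ell_2$ norm and $\|\cdot\|_0$ counts nonzero components. $a\wedge b=\min\{a,b\}$, $(a)_+=\max\{a,0\}$. Oracle. $c_k^2=\min_{\|\beta\|_0\le k}\mathbb E_n[(f_\bullet-x_\bullet'\beta)^2]$, $c_k\ge0$; $s$ is the smallest minimizer of $c_k^2+\sigma^2k/n$ over integers $0\le k\le p\wedge n$; $\beta_0$ is a fixed minimizer of $\mathbb E_n[(f_\bullet-x_\bullet'\beta)^2]$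 over $\|\beta\|_0\le s$; $T=\operatorname{support}(\beta_0)$, $|T|=s$; $c_s$ is $c_k$ at $k=s$. $A^c$ is the complement of $A$ in $\{1,\dots,p\}$; $\delta_A$ has components $\delta_j$ for $j\in A$ and $0$ otherwise; $\beta_{0A}$ means $(\beta_0)_A$. Restricted sparse eigenvalues: over $\delta\ne0$ with $\|\delta_{T^c}\|_0\le m$, $\widetilde\kappa(m)^2=\min\|\delta\|_{2,n}^2/\|\delta\|^2$ and $\phi(m)=\max\|\delta\|_{2,n}^2/\|\delta\|^2$; $\mu(m)=\sqrt{\phi(m)}/\widetilde\kappa(m)$. A constant "independent of $n$" does not depend on quantities indexed by $n$ such as $p$ or $s$. *)

theory Defs
  imports "HOL-Probability.Probability"
begin

text \<open>
  A vector of \<open>\<real>\<^sup>p\<close> is a function \<open>nat \<Rightarrow> real\<close> of which only the coordinates in \<open>{1..p}\<close> are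
  ever used; the sample is indexed by \<open>{1..n}\<close>. The dimension \<open>p\<close> is a number and not a type
  because constants have to be chosen uniformly in \<open>n\<close> and \<open>p\<close>. \<open>x i j\<close> is the \<open>j\<close>-th
  component of the \<open>i\<close>-th regressor.
\<close>

definition emp_avg :: "nat \<Rightarrow> (nat \<Rightarrow> real) \<Rightarrow> real" where
  "emp_avg n g = (\<Sum>i\<in>{1..n}. g i) / real n"

definition emp_norm :: "nat \<Rightarrow> (nat \<Rightarrow> real) \<Rightarrow> real" where
  "emp_norm n g = sqrt (emp_avg n (\<lambda>i. (g i)\<^sup>2))"

definition lin_pred :: "nat \<Rightarrow> (nat \<Rightarrow> nat \<Rightarrow> real) \<Rightarrow> (nat \<Rightarrow> real) \<Rightarrow> nat \<Rightarrow> real" where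
  "lin_pred p x \<beta> i = (\<Sum>j\<in>{1..p}. x i j * \<beta> j)"

definition pred_norm :: "nat \<Rightarrow> nat \<Rightarrow> (nat \<Rightarrow> nat \<Rightarrow> real) \<Rightarrow> (nat \<Rightarrow> real) \<Rightarrow> real" where
  "pred_norm n p x \<delta> = emp_norm n (lin_pred p x \<delta>)"

definition support :: "nat \<Rightarrow> (nat \<Rightarrow> real) \<Rightarrow> nat set" where
  "support p \<beta> = {j\<in>{1..p}. \<beta> j \<noteq> 0}"

definition l0_norm :: "nat \<Rightarrow> (nat \<Rightarrow> real) \<Rightarrow> nat" where
  "l0_norm p \<beta> = card (support p \<beta>)"

definition vec_restrict :: "nat set \<Rightarrow> (nat \<Rightarrow> real) \<Rightarrow> nat \<Rightarrow> real" where
  "vec_restrict A \<delta> = (\<lambda>j. if j \<in> A then \<delta> j else 0)"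

text \<open>
  With \<open>v = y\<close> the following is the least squares criterion \<open>Q(\<beta>)\<close>; with \<open>v i = f (z i)\<close> it is
  the mean squared error of approximating the regression function.
\<close>

definition mean_sq_resid ::
  "nat \<Rightarrow> nat \<Rightarrow> (nat \<Rightarrow> nat \<Rightarrow> real) \<Rightarrow> (nat \<Rightarrow> real) \<Rightarrow> (nat \<Rightarrow> real) \<Rightarrow> real" where
  "mean_sq_resid n p x v \<beta> = emp_avg n (\<lambda>i. (v i - lin_pred p x \<beta> i)\<^sup>2)"

definition oracle_c ::
  "nat \<Rightarrow> nat \<Rightarrow> (nat \<Rightarrow> nat \<Rightarrow> real) \<Rightarrow> (nat \<Rightarrow> real) \<Rightarrow> nat \<Rightarrow> real" where
  "oracle_c n p x v k = sqrt (INF \<beta>\<in>{\<beta>. l0_norm p \<beta> \<le> k}. mean_sq_resid n p x v \<beta>)"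

definition oracle_s ::
  "nat \<Rightarrow> nat \<Rightarrow> (nat \<Rightarrow> nat \<Rightarrow> real) \<Rightarrow> (nat \<Rightarrow> real) \<Rightarrow> real \<Rightarrow> nat" where
  "oracle_s n p x v \<sigma> =
     (LEAST k. is_arg_min (\<lambda>k. (oracle_c n p x v k)\<^sup>2 + \<sigma>\<^sup>2 * real k / real n)
                          (\<lambda>k. k \<le> min p n) k)"

definition restricted_directions :: "nat \<Rightarrow> nat set \<Rightarrow> nat \<Rightarrow> (nat \<Rightarrow> real) set" where
  "restricted_directions p T m =
     {\<delta>. (\<exists>j\<in>{1..p}. \<delta> j \<noteq> 0) \<and> l0_norm p (vec_restrict ({1..p} - T) \<delta>) \<le> m}"

text \<open>
  The set of directions is empty iff \<open>p = 0\<close>, or \<open>T\<close> contains no element of \<open>{1..p}\<close> and \<open>m = 0\<close>.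
  The real \<open>Inf\<close> and \<open>Sup\<close> of the empty set are unspecified, so both extremal values are set
  to \<open>1\<close> there. In particular the condition that the smallest one is positive is then
  vacuously true, as for a minimum over the empty set.
\<close>

definition kappa_tilde ::
  "nat \<Rightarrow> nat \<Rightarrow> (nat \<Rightarrow> nat \<Rightarrow> real) \<Rightarrow> nat set \<Rightarrow> nat \<Rightarrow> real" where
  "kappa_tilde n p x T m =
     (if restricted_directions p T m = {} then 1
      else sqrt (INF \<delta>\<in>restricted_directions p T m.
                   (pred_norm n p x \<delta>)\<^sup>2 / (L2_set \<delta> {1..p})\<^sup>2))"

definition phi_max ::
  "nat \<Rightarrow> nat \<Rightarrow> (nat \<Rightarrow> nat \<Rightarrow> real) \<Rightarrow> nat set \<Rightarrow> nat \<Rightarrow> real" where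
  "phi_max n p x T m =
     (if restricted_directions p T m = {} then 1
      else (SUP \<delta>\<in>restricted_directions p T m.
                   (pred_norm n p x \<delta>)\<^sup>2 / (L2_set \<delta> {1..p})\<^sup>2))"

definition mu ::
  "nat \<Rightarrow> nat \<Rightarrow> (nat \<Rightarrow> nat \<Rightarrow> real) \<Rightarrow> nat set \<Rightarrow> nat \<Rightarrow> real" where
  "mu n p x T m = sqrt (phi_max n p x T m) / kappa_tilde n p x T m"

text \<open>
  \<open>u i\<close> is the noise. That the support of \<open>\<beta>\<^sub>0\<close> has exactly \<open>s\<close> elements is a consequence of
  \<open>s\<close> being the smallest minimizer in \<open>oracle_s\<close>, hence not assumed.
\<close>

locale gaussian_regression = prob_space M
  for M :: "'w measure" +
  fixes n p :: nat
    and z :: "nat \<Rightarrow> 'z"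
    and f :: "'z \<Rightarrow> real"
    and P :: "'z \<Rightarrow> nat \<Rightarrow> real"
    and \<sigma> :: real
    and u :: "nat \<Rightarrow> 'w \<Rightarrow> real"
    and \<beta>\<^sub>0 :: "nat \<Rightarrow> real"
  assumes n_pos: "1 \<le> n"
    and p_pos: "1 \<le> p"
    and sigma_pos: "0 < \<sigma>"
    and noise_indep: "indep_vars (\<lambda>_. borel) u {1..n}"
    and noise_normal: "\<And>i. i \<in> {1..n} \<Longrightarrow> distributed M lborel (u i) (normal_density 0 \<sigma>)"
    and normalized: "\<And>j. j \<in> {1..p} \<Longrightarrow> emp_avg n (\<lambda>i. (P (z i) j)\<^sup>2) = 1"
    and beta0_minimizer: "is_arg_min (mean_sq_resid n p (\<lambda>i. P (z i)) (\<lambda>i. f (z i)))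
                            (\<lambda>\<beta>. l0_norm p \<beta> \<le> oracle_s n p (\<lambda>i. P (z i)) (\<lambda>i. f (z i)) \<sigma>) \<beta>\<^sub>0"

text \<open>
  \<open>bh \<omega>\<close> is the first-step estimate. The hypotheses on the selected model involve random
  quantities and are required almost surely. No measurability of \<open>bh\<close> is assumed: a claim that
  holds with probability at least \<open>q\<close> is to be stated as holding on some measurable event of
  probability at least \<open>q\<close>.
\<close>

definition admissible_selector ::
  "'w measure \<Rightarrow> nat \<Rightarrow> nat \<Rightarrow> (nat \<Rightarrow> nat \<Rightarrow> real) \<Rightarrow> (nat \<Rightarrow> real) \<Rightarrow> ('w \<Rightarrow> nat \<Rightarrow> real) \<Rightarrow> bool" where
  "admissible_selector M n p x \<beta>\<^sub>0 bh \<longleftrightarrow>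
     (AE \<omega> in M. card (support p (bh \<omega>)) \<le> n \<and>
        kappa_tilde n p x (support p \<beta>\<^sub>0) (card (support p (bh \<omega>) - support p \<beta>\<^sub>0)) > 0)"

definition post_selection_ls ::
  "nat \<Rightarrow> nat \<Rightarrow> (nat \<Rightarrow> nat \<Rightarrow> real) \<Rightarrow> (nat \<Rightarrow> real) \<Rightarrow> nat set \<Rightarrow> (nat \<Rightarrow> real) \<Rightarrow> bool" where
  "post_selection_ls n p x y Th \<beta> \<longleftrightarrow>
     is_arg_min (mean_sq_resid n p x y) (\<lambda>b. \<forall>j\<in>{1..p} - Th. b j = 0) \<beta>"

end

theory Submission
  imports Defs
begin

text \<open>
  With \<open>\<delta> = b - \<beta>\<^sub>0\<close>, the difference \<open>Q(b) - Q(\<beta>\<^sub>0)\<close> is \<open>\<parallel>\<delta>\<parallel>\<^sup>2\<close> minus two cross terms. The one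
  with the approximation error \<open>f - x'\<beta>\<^sub>0\<close> is at most \<open>2 c\<^sub>s \<parallel>\<delta>\<parallel>\<close> by Cauchy-Schwarz. The one
  with the noise, for \<open>\<delta>\<close> supported in \<open>S\<close>, is at most \<open>2 \<parallel>\<delta>\<parallel>\<close> times the norm of the projection
  of the noise onto the span of the regressors in \<open>S\<close>, whose square is a chi-square variable with
  at most \<open>|S|\<close> degrees of freedom. The exponential moment of that variable and a union bound over
  the supports \<open>S \<supseteq> T\<close>, respectively \<open>S \<subseteq> T\<close>, give both rates. No covering argument is needed:
  the eigenvalue ratio enters only through \<open>\<mu> \<ge> 1\<close>, so that \<open>ln (e \<mu>) \<ge> 1\<close> absorbs the dimension
  of the span. The estimation error bound follows by solving the quadratic inequality
  \<open>D\<^sup>2 \<le> a D + b\<close> that optimality of the post-selection estimator yields.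
\<close>

subsection \<open>Orthonormal families of sample vectors\<close>

text \<open>The sum is not divided by the sample size: the noise coordinate along a unit vector then
  has variance exactly \<open>\<sigma>\<^sup>2\<close>.\<close>

definition inner_on :: "'i set \<Rightarrow> ('i \<Rightarrow> real) \<Rightarrow> ('i \<Rightarrow> real) \<Rightarrow> real" where
  "inner_on I a b = (\<Sum>i\<in>I. a i * b i)"

lemma inner_on_commute: "inner_on I a b = inner_on I b a"
  by (simp add: inner_on_def mult.commute)

lemma inner_on_add: "inner_on I a (\<lambda>i. b i + c i) = inner_on I a b + inner_on I a c"
  by (simp add: inner_on_def algebra_simps sum.distrib)

lemma inner_on_diff: "inner_on I a (\<lambda>i. b i - c i) = inner_on I a b - inner_on I a c"
  by (simp add: inner_on_def algebra_simps sum_subtractf)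

lemma inner_on_scale: "inner_on I a (\<lambda>i. c * b i) = c * inner_on I a b"
  by (simp add: inner_on_def algebra_simps sum_distrib_left)

lemma inner_on_add_left: "inner_on I (\<lambda>i. b i + c i) a = inner_on I b a + inner_on I c a"
  by (simp add: inner_on_def algebra_simps sum.distrib)

lemma inner_on_scale_left: "inner_on I (\<lambda>i. c * b i) a = c * inner_on I b a"
  by (simp add: inner_on_def algebra_simps sum_distrib_left)

lemma inner_on_sum: "inner_on I a (\<lambda>i. \<Sum>v\<in>V. b v i) = (\<Sum>v\<in>V. inner_on I a (b v))"
  unfolding inner_on_def sum_distrib_left by (rule sum.swap)

lemma inner_on_cong: "(\<And>i. i \<in> I \<Longrightarrow> b i = c i) \<Longrightarrow> inner_on I a b = inner_on I a c"
  by (simp add: inner_on_def)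

lemma inner_on_self_nonneg: "0 \<le> inner_on I a a"
  by (simp add: inner_on_def sum_nonneg)

text \<open>Here \<open>v = w\<close> is equality of functions, while the inner product sees only
  values on \<open>I\<close>. The condition thus excludes two members that differ only outside
  \<open>I\<close>.\<close>

definition orthonormal_on :: "'i set \<Rightarrow> ('i \<Rightarrow> real) set \<Rightarrow> bool" where
  "orthonormal_on I V \<longleftrightarrow> (\<forall>v\<in>V. \<forall>w\<in>V. inner_on I v w = of_bool (v = w))"

text \<open>For orthonormal \<open>V\<close> this is membership in the span of \<open>V\<close> on
  \<open>I\<close>, with the coefficients given explicitly as inner products.\<close>

definition in_span_on :: "'i set \<Rightarrow> ('i \<Rightarrow> real) set \<Rightarrow> ('i \<Rightarrow> real) \<Rightarrow> bool" where
  "in_span_on I V a \<longleftrightarrow> (\<forall>i\<in>I. a i = (\<Sum>v\<in>V. inner_on I v a * v i))"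

text \<open>Each new vector either lies in the span already built, or its normalized residual is
  adjoined. The vectors may be dependent, so \<open>V\<close> can have fewer elements than
  \<open>S\<close>.\<close>

lemma gram_schmidt_on:
  fixes X :: "'a \<Rightarrow> 'i \<Rightarrow> real"
  assumes "finite I" "finite S"
  shows "\<exists>V. finite V \<and> card V \<le> card S \<and> orthonormal_on I V \<and> (\<forall>j\<in>S. in_span_on I V (X j))"
  using \<open>finite S\<close>
proof induction
  case empty
  show ?case by (rule exI[of _ "{}"]) (simp add: orthonormal_on_def)
next
  case (insert j S)
  then obtain V where V: "finite V" "card V \<le> card S" "orthonormal_on I V"
    "\<forall>j\<in>S. in_span_on I V (X j)" by blast
  define r where "r i = X j i - (\<Sum>v\<in>V. inner_on I v (X j) * v i)" for i
  have r_orth: "inner_on I v r = 0" if "v \<in> V" for v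
  proof -
    have "inner_on I v r = inner_on I v (X j) - (\<Sum>w\<in>V. inner_on I w (X j) * inner_on I v w)"
      unfolding r_def inner_on_diff inner_on_sum inner_on_scale ..
    also have "(\<Sum>w\<in>V. inner_on I w (X j) * inner_on I v w) = (\<Sum>w\<in>V. if w = v then inner_on I w (X j) else 0)"
      using V(3) that by (intro sum.cong) (auto simp: orthonormal_on_def)
    also have "\<dots> = inner_on I v (X j)"
      using V(1) that by simp
    finally show ?thesis by simp
  qed
  show ?case
  proof (cases "\<forall>i\<in>I. r i = 0")
    case True
    then have "in_span_on I V (X j)"
      by (simp add: in_span_on_def r_def)
    with V insert.hyps show ?thesis by (intro exI[of _ V]) auto
  next
    case False
    define \<rho> where "\<rho> = sqrt (inner_on I r r)"
    have "inner_on I r r > 0"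
      using False \<open>finite I\<close> unfolding inner_on_def
      by (metis (lifting) not_real_square_gt_zero sum_pos2 zero_le_square)
    then have \<rho>: "\<rho> > 0" "\<rho>\<^sup>2 = inner_on I r r" by (auto simp: \<rho>_def)
    define e where "e = (\<lambda>i. (1 / \<rho>) * r i)"
    have e_orth: "inner_on I v e = 0" if "v \<in> V" for v
      unfolding e_def inner_on_scale using r_orth[OF that] by simp
    have r_e: "inner_on I r e = \<rho>"
      unfolding e_def inner_on_scale \<rho>(2)[symmetric] using \<rho>(1) by (simp add: power2_eq_square)
    then have e_r: "inner_on I e r = \<rho>" by (simp only: inner_on_commute[of I e r])
    have "inner_on I e e = (1 / \<rho>) * inner_on I e r"
      by (subst (2) e_def) (rule inner_on_scale)
    with e_r \<rho>(1) have e_e: "inner_on I e e = 1" by simp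
    have e_orth': "inner_on I e v = 0" if "v \<in> V" for v
      using e_orth[OF that] by (simp add: inner_on_commute[of I e v])
    have "e \<notin> V" using e_orth[of e] e_e by auto
    have "orthonormal_on I (insert e V)"
      using V(3) e_orth e_e \<open>e \<notin> V\<close> e_orth'
      by (auto simp: orthonormal_on_def)
    moreover have "in_span_on I (insert e V) (X k)" if "k \<in> S" for k
    proof -
      have "inner_on I e (X k) = inner_on I e (\<lambda>i. \<Sum>v\<in>V. inner_on I v (X k) * v i)"
        using V(4) that by (intro inner_on_cong) (auto simp: in_span_on_def)
      also have "\<dots> = 0"
        unfolding inner_on_sum inner_on_scale by (simp add: e_orth')
      finally show ?thesis
        using V(1,4) that \<open>e \<notin> V\<close> by (auto simp: in_span_on_def)
    qed
    moreover have "in_span_on I (insert e V) (X j)"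
    proof -
      have "inner_on I e (X j) = inner_on I e (\<lambda>i. r i + (\<Sum>v\<in>V. inner_on I v (X j) * v i))"
        by (intro inner_on_cong) (simp add: r_def)
      also have "\<dots> = \<rho>"
        unfolding inner_on_add inner_on_sum inner_on_scale
        using e_r by (simp add: e_orth')
      finally show ?thesis
        using V(1) \<open>e \<notin> V\<close> \<rho>(1) by (auto simp: in_span_on_def e_def r_def)
    qed
    moreover have "card (insert e V) \<le> card (insert j S)"
      using V insert.hyps \<open>e \<notin> V\<close> by simp
    ultimately show ?thesis using V(1) by (intro exI[of _ "insert e V"]) auto
  qed
qed

lemma in_span_on_lin_comb:
  assumes "finite V" "\<And>j. j \<in> S \<Longrightarrow> in_span_on I V (X j)"
  shows "in_span_on I V (\<lambda>i. \<Sum>j\<in>S. X j i * \<delta> j)"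
  unfolding in_span_on_def
proof
  fix i assume i: "i \<in> I"
  have "(\<Sum>j\<in>S. X j i * \<delta> j) = (\<Sum>j\<in>S. \<Sum>v\<in>V. \<delta> j * inner_on I v (X j) * v i)"
    using assms(2) i
    by (intro sum.cong refl) (auto simp: in_span_on_def sum_distrib_right sum_distrib_left mult_ac)
  also have "\<dots> = (\<Sum>v\<in>V. \<Sum>j\<in>S. \<delta> j * inner_on I v (X j) * v i)" by (rule sum.swap)
  also have "\<dots> = (\<Sum>v\<in>V. inner_on I v (\<lambda>i. \<Sum>j\<in>S. X j i * \<delta> j) * v i)"
    unfolding inner_on_sum
    by (simp add: mult.commute[of _ "\<delta> _"] inner_on_scale sum_distrib_right)
  finally show "(\<Sum>j\<in>S. X j i * \<delta> j) = (\<Sum>v\<in>V. inner_on I v (\<lambda>i. \<Sum>j\<in>S. X j i * \<delta> j) * v i)" .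
qed

text \<open>Parseval, then Cauchy-Schwarz in the coordinates. The first factor on the right does not
  involve \<open>a\<close>, so one bound on it controls the whole span.\<close>

lemma inner_on_in_span_le:
  assumes "in_span_on I V a"
  shows "(inner_on I b a)\<^sup>2 \<le> (\<Sum>v\<in>V. (inner_on I b v)\<^sup>2) * inner_on I a a"
proof -
  have expand: "inner_on I c a = (\<Sum>v\<in>V. inner_on I v a * inner_on I c v)" for c
  proof -
    have "inner_on I c a = inner_on I c (\<lambda>i. \<Sum>v\<in>V. inner_on I v a * v i)"
      using assms by (intro inner_on_cong) (auto simp: in_span_on_def)
    then show ?thesis by (simp add: inner_on_sum inner_on_scale)
  qed
  have "inner_on I a a = (\<Sum>v\<in>V. (inner_on I v a)\<^sup>2)"
    unfolding expand[of a] power2_eq_square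
    by (intro sum.cong refl) (metis inner_on_commute)
  then show ?thesis
    using expand[of b] Cauchy_Schwarz_ineq_sum[of "\<lambda>v. inner_on I b v" "\<lambda>v. inner_on I v a" V]
    by (simp add: mult.commute)
qed

subsection \<open>Exponential moments and tails of projected Gaussian noise\<close>

lemma nn_integral_normal_density:
  assumes "0 < \<sigma>"
  shows "(\<integral>\<^sup>+x. ennreal (normal_density \<mu> \<sigma> x) \<partial>lborel) = 1"
  using assms by (simp add: nn_integral_eq_integral integrable_normal_density)

text \<open>Completing the square: tilting by \<open>exp (t * x)\<close> moves the mean of the
  density to \<open>\<sigma>\<^sup>2 * t\<close>, and the constant left over is the moment
  generating function.\<close>

lemma nn_integral_normal_exp_linear:
  fixes t \<sigma> :: real
  assumes "0 < \<sigma>"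
  shows "(\<integral>\<^sup>+x. ennreal (normal_density 0 \<sigma> x) * ennreal (exp (t * x)) \<partial>lborel)
    = ennreal (exp (\<sigma>\<^sup>2 * t\<^sup>2 / 2))"
proof -
  have "normal_density 0 \<sigma> x * exp (t * x) = exp (\<sigma>\<^sup>2 * t\<^sup>2 / 2) * normal_density (\<sigma>\<^sup>2 * t) \<sigma> x" for x
    using assms
    by (simp add: normal_density_def exp_add[symmetric])
      (simp add: field_simps power2_eq_square)
  then have "(\<integral>\<^sup>+x. ennreal (normal_density 0 \<sigma> x) * ennreal (exp (t * x)) \<partial>lborel)
     = (\<integral>\<^sup>+x. ennreal (exp (\<sigma>\<^sup>2 * t\<^sup>2 / 2)) * ennreal (normal_density (\<sigma>\<^sup>2 * t) \<sigma> x) \<partial>lborel)"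
    by (simp add: ennreal_mult'[symmetric])
  also have "\<dots> = ennreal (exp (\<sigma>\<^sup>2 * t\<^sup>2 / 2))"
    using assms by (simp add: nn_integral_cmult nn_integral_normal_density)
  finally show ?thesis .
qed

text \<open>The factor halves the Gaussian exponent, which gives variance 2; the ratio of the
  normalizing constants is \<open>sqrt 2\<close>.\<close>

lemma nn_integral_std_normal_exp_square:
  "(\<integral>\<^sup>+g. ennreal (std_normal_density g) * ennreal (exp (g\<^sup>2 / 4)) \<partial>lborel) = ennreal (sqrt 2)"
proof -
  have "std_normal_density g * exp (g\<^sup>2 / 4) = sqrt 2 * normal_density 0 (sqrt 2) g" for g
    by (simp add: normal_density_def exp_add[symmetric] real_sqrt_mult field_simps)
  then have "(\<integral>\<^sup>+g. ennreal (std_normal_density g) * ennreal (exp (g\<^sup>2 / 4)) \<partial>lborel)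
     = (\<integral>\<^sup>+g. ennreal (sqrt 2) * ennreal (normal_density 0 (sqrt 2) g) \<partial>lborel)"
    by (simp add: ennreal_mult'[symmetric])
  also have "\<dots> = ennreal (sqrt 2)"
    by (simp add: nn_integral_cmult nn_integral_normal_density)
  finally show ?thesis .
qed

context gaussian_regression
begin

lemma noise_measurable [measurable]: "i \<in> {1..n} \<Longrightarrow> u i \<in> borel_measurable M"
  using noise_indep by (simp add: indep_vars_def)

lemma inner_noise_measurable [measurable]:
  "(\<lambda>\<omega>. inner_on {1..n} (\<lambda>i. u i \<omega>) a) \<in> borel_measurable M"
  unfolding inner_on_def by measurable

text \<open>By independence the integral factors into the moment generating functions of the single
  \<open>u i\<close>.\<close>

lemma nn_integral_exp_inner_noise:
  "(\<integral>\<^sup>+\<omega>. ennreal (exp (inner_on {1..n} (\<lambda>i. u i \<omega>) a)) \<partial>M)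
    = ennreal (exp (\<sigma>\<^sup>2 * inner_on {1..n} a a / 2))"
proof -
  have one: "(\<integral>\<^sup>+\<omega>. ennreal (exp (a i * u i \<omega>)) \<partial>M) = ennreal (exp (\<sigma>\<^sup>2 * (a i)\<^sup>2 / 2))"
    if "i \<in> {1..n}" for i
    using distributed_nn_integral[OF noise_normal[OF that], of "\<lambda>x. ennreal (exp (a i * x))"]
      nn_integral_normal_exp_linear[OF sigma_pos, of "a i"] by simp
  have "(\<integral>\<^sup>+\<omega>. ennreal (exp (inner_on {1..n} (\<lambda>i. u i \<omega>) a)) \<partial>M)
      = (\<integral>\<^sup>+\<omega>. (\<Prod>i\<in>{1..n}. ennreal (exp (a i * u i \<omega>))) \<partial>M)"
    by (simp add: inner_on_def exp_sum prod_ennreal mult.commute)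
  also have "\<dots> = (\<Prod>i\<in>{1..n}. \<integral>\<^sup>+\<omega>. ennreal (exp (a i * u i \<omega>)) \<partial>M)"
    by (intro indep_vars_nn_integral indep_vars_compose2[OF noise_indep]) auto
  also have "\<dots> = (\<Prod>i\<in>{1..n}. ennreal (exp (\<sigma>\<^sup>2 * (a i)\<^sup>2 / 2)))"
    using one by (intro prod.cong) auto
  also have "\<dots> = ennreal (exp (\<sigma>\<^sup>2 * inner_on {1..n} a a / 2))"
    by (simp add: prod_ennreal inner_on_def power2_eq_square sum_distrib_left sum_divide_distrib
        flip: exp_sum)
  finally show ?thesis .
qed

text \<open>
  One squared term is linearized by \<open>exp (b\<^sup>2 / 2) = E (exp (g b))\<close> for a standard normal \<open>g\<close>.
  The linear term it leaves is orthogonal to the remaining vectors, which is why the induction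
  carries the additional vector \<open>a\<close>.
\<close>

lemma nn_integral_exp_inner_noise_squares:
  assumes "finite V" "orthonormal_on {1..n} V" "\<And>v. v \<in> V \<Longrightarrow> inner_on {1..n} v a = 0"
  shows "(\<integral>\<^sup>+\<omega>. ennreal (exp (inner_on {1..n} (\<lambda>i. u i \<omega>) a
             + (\<Sum>v\<in>V. (inner_on {1..n} (\<lambda>i. u i \<omega>) v)\<^sup>2) / (4 * \<sigma>\<^sup>2))) \<partial>M)
    = ennreal (sqrt 2 ^ card V * exp (\<sigma>\<^sup>2 * inner_on {1..n} a a / 2))"
  using assms
proof (induction V arbitrary: a)
  case empty
  then show ?case using nn_integral_exp_inner_noise[of a] by simp
next
  case (insert v V)
  let ?U = "\<lambda>\<omega> a. inner_on {1..n} (\<lambda>i. u i \<omega>) a"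
  let ?R = "\<lambda>\<omega>. (\<Sum>v\<in>V. (?U \<omega> v)\<^sup>2) / (4 * \<sigma>\<^sup>2)"
  \<comment> \<open>Chosen so that \<open>(\<tau> * b)\<^sup>2 / 2 = b\<^sup>2 / (4 *
    \<sigma>\<^sup>2)\<close>, the exponent to be linearized.\<close>
  define \<tau> where "\<tau> = 1 / (sqrt 2 * \<sigma>)"
  interpret L: pair_sigma_finite M lborel ..
  have orth: "orthonormal_on {1..n} V" using insert.prems by (auto simp: orthonormal_on_def)
  have "inner_on {1..n} v v = 1" using insert.prems by (auto simp: orthonormal_on_def)
  \<comment> \<open>The cross terms vanish because \<open>v\<close> is orthogonal to
    \<open>a\<close>.\<close>
  then have norm: "inner_on {1..n} (\<lambda>i. a i + \<tau> * g * v i) (\<lambda>i. a i + \<tau> * g * v i)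
      = inner_on {1..n} a a + \<tau>\<^sup>2 * g\<^sup>2" for g
    using insert.prems(2)[of v] inner_on_commute[of "{1..n}" a v]
    by (simp add: inner_on_add inner_on_scale inner_on_add_left inner_on_scale_left power2_eq_square)
  have lin: "ennreal (exp ((?U \<omega> v)\<^sup>2 / (4 * \<sigma>\<^sup>2)))
      = (\<integral>\<^sup>+g. ennreal (std_normal_density g) * ennreal (exp (\<tau> * ?U \<omega> v * g)) \<partial>lborel)" for \<omega>
    using nn_integral_normal_exp_linear[of 1 "\<tau> * ?U \<omega> v"] sigma_pos
    by (simp add: \<tau>_def power_mult_distrib power_divide)
  have "(\<integral>\<^sup>+\<omega>. ennreal (exp (?U \<omega> a + (\<Sum>v\<in>insert v V. (?U \<omega> v)\<^sup>2) / (4 * \<sigma>\<^sup>2))) \<partial>M)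
      = (\<integral>\<^sup>+\<omega>. ennreal (exp (?U \<omega> a + ?R \<omega>)) * ennreal (exp ((?U \<omega> v)\<^sup>2 / (4 * \<sigma>\<^sup>2))) \<partial>M)"
    using insert.hyps
    by (intro nn_integral_cong) (simp add: add_divide_distrib ac_simps flip: ennreal_mult' exp_add)
  also have "\<dots> = (\<integral>\<^sup>+\<omega>. (\<integral>\<^sup>+g. ennreal (std_normal_density g) *
      ennreal (exp (?U \<omega> (\<lambda>i. a i + \<tau> * g * v i) + ?R \<omega>)) \<partial>lborel) \<partial>M)"
    unfolding lin
    by (subst nn_integral_cmult[symmetric])
      (auto intro!: nn_integral_cong simp: inner_on_add inner_on_scale ac_simps
        simp flip: ennreal_mult' exp_add)
  \<comment> \<open>Tonelli: everything is nonnegative, so the auxiliary Gaussian can be integrated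
    last and the induction hypothesis applies for each fixed \<open>g\<close>.\<close>
  also have "\<dots> = (\<integral>\<^sup>+g. (\<integral>\<^sup>+\<omega>. ennreal (std_normal_density g) *
      ennreal (exp (?U \<omega> (\<lambda>i. a i + \<tau> * g * v i) + ?R \<omega>)) \<partial>M) \<partial>lborel)"
    unfolding inner_on_add inner_on_scale by (rule L.Fubini'[symmetric]) measurable
  also have "\<dots> = (\<integral>\<^sup>+g. ennreal (std_normal_density g) *
      ennreal (sqrt 2 ^ card V * exp (\<sigma>\<^sup>2 * (inner_on {1..n} a a + \<tau>\<^sup>2 * g\<^sup>2) / 2)) \<partial>lborel)"
  proof (intro nn_integral_cong)
    fix g :: real
    have IH: "(\<integral>\<^sup>+\<omega>. ennreal (exp (?U \<omega> (\<lambda>i. a i + \<tau> * g * v i) + ?R \<omega>)) \<partial>M)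
       = ennreal (sqrt 2 ^ card V * exp (\<sigma>\<^sup>2 * inner_on {1..n} (\<lambda>i. a i + \<tau> * g * v i) (\<lambda>i. a i + \<tau> * g * v i) / 2))"
    proof (rule insert.IH[OF orth])
      fix w assume "w \<in> V"
      then have "inner_on {1..n} w v = 0" "inner_on {1..n} w a = 0"
        using insert.prems insert.hyps by (auto simp: orthonormal_on_def)
      then show "inner_on {1..n} w (\<lambda>i. a i + \<tau> * g * v i) = 0"
        by (simp add: inner_on_add inner_on_scale)
    qed
    show "(\<integral>\<^sup>+\<omega>. ennreal (std_normal_density g) *
      ennreal (exp (?U \<omega> (\<lambda>i. a i + \<tau> * g * v i) + ?R \<omega>)) \<partial>M) = ennreal (std_normal_density g) *
      ennreal (sqrt 2 ^ card V * exp (\<sigma>\<^sup>2 * (inner_on {1..n} a a + \<tau>\<^sup>2 * g\<^sup>2) / 2))"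
      by (subst nn_integral_cmult) (measurable, simp only: IH norm)
  qed
  \<comment> \<open>Since \<open>\<sigma>\<^sup>2 * \<tau>\<^sup>2 / 2 = 1 / 4\<close>, the
    remaining integral over \<open>g\<close> contributes one more factor
    \<open>sqrt 2\<close>.\<close>
  also have "\<dots> = (\<integral>\<^sup>+g. ennreal (sqrt 2 ^ card V * exp (\<sigma>\<^sup>2 * inner_on {1..n} a a / 2)) *
     (ennreal (std_normal_density g) * ennreal (exp (g\<^sup>2 / 4))) \<partial>lborel)"
    using sigma_pos
    by (intro nn_integral_cong)
      (simp add: \<tau>_def power_mult_distrib power_divide distrib_left add_divide_distrib exp_add ac_simps
        flip: ennreal_mult')
  also have "\<dots> = ennreal (sqrt 2 ^ card (insert v V) * exp (\<sigma>\<^sup>2 * inner_on {1..n} a a / 2))"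
    using insert.hyps
    by (subst nn_integral_cmult, measurable, subst nn_integral_std_normal_exp_square)
      (simp add: ac_simps flip: ennreal_mult')
  finally show ?case .
qed

end

section \<open>Tail bounds and the union bound over supports\<close>

lemma sum_powers_le:
  fixes r :: real
  assumes "finite A" "0 \<notin> A" "0 \<le> r" "r < 1"
  shows "(\<Sum>k\<in>A. r ^ k) \<le> r / (1 - r)"
proof -
  \<comment> \<open>Filling the gaps in the set of exponents gives a full geometric sum that starts
    at exponent 1.\<close>
  have "A \<subseteq> {1..Max A}"
    using assms(1,2) by (auto simp: Suc_le_eq intro: gr0I Max_ge)
  then have "(\<Sum>k\<in>A. r ^ k) \<le> (\<Sum>k\<in>{1..Max A}. r ^ k)"
    using assms by (intro sum_mono2) auto
  also have "\<dots> = r * (\<Sum>k<Max A. r ^ k)"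
    by (simp add: sum.atLeast1_atMost_eq sum_distrib_left)
  also have "\<dots> = r * (1 - r ^ Max A) / (1 - r)"
    using assms by (simp add: sum_gp_strict)
  also have "\<dots> \<le> r / (1 - r)"
    using assms by (intro divide_right_mono) (auto simp: mult_left_le)
  finally show ?thesis .
qed

text \<open>The solution \<open>c\<close> of \<open>r / (1 - r) = \<eta>\<close> for
  \<open>r = exp (1 - c)\<close>. The summand 1 offsets the factor \<open>exp 1\<close> that each
  dimension costs in the tail bound for the projected noise.\<close>

definition tail_const :: "real \<Rightarrow> real" where
  "tail_const \<eta> = 1 + ln ((1 + \<eta>) / \<eta>)"

lemma tail_const_ge_1: "0 < \<eta> \<Longrightarrow> 1 \<le> tail_const \<eta>"
  by (simp add: tail_const_def)

lemma exp_tail_const: "0 < \<eta> \<Longrightarrow> exp (1 - tail_const \<eta>) = \<eta> / (1 + \<eta>)"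
  by (simp add: tail_const_def exp_minus)

context gaussian_regression
begin

text \<open>Markov's inequality for the exponential moment of the squared coordinates, taken with
  linear term \<open>a = 0\<close>.\<close>

lemma prob_noise_projection_gt:
  assumes "finite V" "orthonormal_on {1..n} V"
  shows "prob {\<omega>\<in>space M. 4 * \<sigma>\<^sup>2 * L < (\<Sum>v\<in>V. (inner_on {1..n} (\<lambda>i. u i \<omega>) v)\<^sup>2)}
     \<le> exp (real (card V) - L)" (is "prob ?E \<le> _")
proof -
  let ?X = "\<lambda>\<omega>. (\<Sum>v\<in>V. (inner_on {1..n} (\<lambda>i. u i \<omega>) v)\<^sup>2) / (4 * \<sigma>\<^sup>2)"
  have E: "?E \<subseteq> {\<omega>\<in>space M. 1 \<le> ennreal (exp (-L)) * ennreal (exp (?X \<omega>))}"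
    using sigma_pos by (auto simp: ennreal_mult'[symmetric] exp_add[symmetric] field_simps)
  have "emeasure M ?E \<le> emeasure M {\<omega>\<in>space M. 1 \<le> ennreal (exp (-L)) * ennreal (exp (?X \<omega>))}"
    by (rule emeasure_mono[OF E]) measurable
  also have "\<dots> \<le> ennreal (exp (-L)) * (\<integral>\<^sup>+\<omega>. ennreal (exp (?X \<omega>)) * indicator (space M) \<omega> \<partial>M)"
    by (rule nn_integral_Markov_inequality) measurable
  also have "(\<integral>\<^sup>+\<omega>. ennreal (exp (?X \<omega>)) * indicator (space M) \<omega> \<partial>M) = (\<integral>\<^sup>+\<omega>. ennreal (exp (?X \<omega>)) \<partial>M)"
    by (intro nn_integral_cong) auto
  also have "\<dots> = ennreal (sqrt 2 ^ card V)"
    using nn_integral_exp_inner_noise_squares[OF assms, of "\<lambda>_. 0"] by (simp add: inner_on_def)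
  also have "ennreal (exp (-L)) * ennreal (sqrt 2 ^ card V) \<le> ennreal (exp (real (card V) - L))"
  \<comment> \<open>Replacing \<open>sqrt 2\<close> by the larger \<open>exp 1\<close> turns the
    bound into a single exponential.\<close>
  proof -
    have "sqrt 2 \<le> exp (1::real)"
      using exp_ge_add_one_self[of "1::real"] sqrt2_less_2 by linarith
    then have "sqrt 2 ^ card V \<le> exp (1::real) ^ card V" by (intro power_mono) auto
    then have "exp (-L) * sqrt 2 ^ card V \<le> exp (-L) * exp (1::real) ^ card V"
      by (rule mult_left_mono) simp
    also have "\<dots> = exp (real (card V) - L)"
      using exp_of_nat_mult[of "card V" "1::real"] by (simp add: exp_diff exp_minus field_simps)
    finally show ?thesis by (simp flip: ennreal_mult')
  qed
  finally show ?thesis by (simp add: emeasure_eq_measure)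
qed

text \<open>The exceptional event says that the projection of the noise onto the span of the columns
  in \<open>S\<close> is large. It does not depend on \<open>\<delta>\<close>, so a data-dependent
  vector may be inserted later.\<close>

lemma noise_supported_bound:
  assumes "finite S"
  shows "\<exists>E\<in>sets M. prob E \<le> exp (real (card S) - L) \<and> (\<forall>\<omega>\<in>space M - E. \<forall>\<delta>.
     (inner_on {1..n} (\<lambda>i. u i \<omega>) (\<lambda>i. \<Sum>j\<in>S. x i j * \<delta> j))\<^sup>2
     \<le> 4 * \<sigma>\<^sup>2 * L * inner_on {1..n} (\<lambda>i. \<Sum>j\<in>S. x i j * \<delta> j) (\<lambda>i. \<Sum>j\<in>S. x i j * \<delta> j))"
proof -
  obtain V where V: "finite V" "card V \<le> card S" "orthonormal_on {1..n} V"
      "\<forall>j\<in>S. in_span_on {1..n} V (\<lambda>i. x i j)"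
    using gram_schmidt_on[of "{1..n}" S "\<lambda>j i. x i j"] assms by auto
  let ?E = "{\<omega>\<in>space M. 4 * \<sigma>\<^sup>2 * L < (\<Sum>v\<in>V. (inner_on {1..n} (\<lambda>i. u i \<omega>) v)\<^sup>2)}"
  have "prob ?E \<le> exp (real (card S) - L)"
    by (rule order_trans[OF prob_noise_projection_gt[OF V(1,3)]]) (use V(2) in simp)
  moreover have "?E \<in> sets M" by measurable
  moreover have "(inner_on {1..n} (\<lambda>i. u i \<omega>) (\<lambda>i. \<Sum>j\<in>S. x i j * \<delta> j))\<^sup>2
     \<le> 4 * \<sigma>\<^sup>2 * L * inner_on {1..n} (\<lambda>i. \<Sum>j\<in>S. x i j * \<delta> j) (\<lambda>i. \<Sum>j\<in>S. x i j * \<delta> j)"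
    if "\<omega> \<in> space M - ?E" for \<omega> \<delta>
  proof -
    have "in_span_on {1..n} V (\<lambda>i. \<Sum>j\<in>S. x i j * \<delta> j)"
      using in_span_on_lin_comb[OF V(1), of S _ "\<lambda>j i. x i j"] V(4) by blast
    from inner_on_in_span_le[OF this, of "\<lambda>i. u i \<omega>"] show ?thesis
      by (rule order_trans) (use that in \<open>auto intro!: mult_right_mono inner_on_self_nonneg\<close>)
  qed
  ultimately show ?thesis by blast
qed

text \<open>
  The weight \<open>ln N\<close>, with \<open>N\<close> the number of competing supports of the same size, cancels the
  size of each layer of the union bound, which leaves a geometric series in the size of \<open>S\<close>.
\<close>

lemma noise_uniform_bound:
  fixes x :: "nat \<Rightarrow> 'a \<Rightarrow> real"
  assumes "finite F" "\<forall>S\<in>F. finite S \<and> S \<noteq> {}" "0 < \<eta>"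
  shows "\<exists>E\<in>sets M. prob E \<ge> 1 - \<eta> \<and> (\<forall>\<omega>\<in>E. \<forall>S\<in>F. \<forall>\<delta>.
     (inner_on {1..n} (\<lambda>i. u i \<omega>) (\<lambda>i. \<Sum>j\<in>S. x i j * \<delta> j))\<^sup>2
     \<le> 4 * \<sigma>\<^sup>2 * (ln (real (card {S'\<in>F. card S' = card S})) + tail_const \<eta> * real (card S))
        * inner_on {1..n} (\<lambda>i. \<Sum>j\<in>S. x i j * \<delta> j) (\<lambda>i. \<Sum>j\<in>S. x i j * \<delta> j))"
proof -
  define N where "N k = card {S\<in>F. card S = k}" for k
  define L where "L S = ln (real (N (card S))) + tail_const \<eta> * real (card S)" for S :: "'a set"
  \<comment> \<open>The ratio of the geometric series: with the level \<open>L S\<close>, the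
    exceptional event of \<open>S\<close> costs at most
    \<open>r ^ card S / N (card S)\<close>.\<close>
  define r where "r = exp (1 - tail_const \<eta>)"
  have r: "0 \<le> r" "r < 1" "r / (1 - r) = \<eta>"
    using \<open>0 < \<eta>\<close> by (auto simp: r_def exp_tail_const field_simps)
  let ?X = "\<lambda>S \<delta> i. \<Sum>j\<in>S. x i j * \<delta> j"
  let ?good = "\<lambda>S \<omega>. \<forall>\<delta>. (inner_on {1..n} (\<lambda>i. u i \<omega>) (?X S \<delta>))\<^sup>2
     \<le> 4 * \<sigma>\<^sup>2 * L S * inner_on {1..n} (?X S \<delta>) (?X S \<delta>)"
  have "\<forall>S\<in>F. \<exists>E. E \<in> sets M \<and> prob E \<le> exp (real (card S) - L S) \<and> (\<forall>\<omega>\<in>space M - E. ?good S \<omega>)"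
  proof
    fix S assume "S \<in> F"
    then have "finite S" using assms(2) by blast
    from noise_supported_bound[OF this, of "L S" x]
    show "\<exists>E. E \<in> sets M \<and> prob E \<le> exp (real (card S) - L S) \<and> (\<forall>\<omega>\<in>space M - E. ?good S \<omega>)"
      unfolding Bex_def .
  qed
  from bchoice[OF this] obtain E where
    E: "\<And>S. S \<in> F \<Longrightarrow> E S \<in> sets M" "\<And>S. S \<in> F \<Longrightarrow> prob (E S) \<le> exp (real (card S) - L S)"
       "\<And>S \<omega>. S \<in> F \<Longrightarrow> \<omega> \<in> space M - E S \<Longrightarrow> ?good S \<omega>"
    by blast
  have N_pos: "0 < N (card S)" if "S \<in> F" for S
    using assms(1) that by (auto simp: N_def card_gt_0_iff)
  have layer: "exp (real (card S) - L S) = r ^ card S / real (N (card S))" if "S \<in> F" for S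
  proof -
    have "real (card S) - L S = real (card S) * (1 - tail_const \<eta>) - ln (real (N (card S)))"
      by (simp add: L_def algebra_simps)
    then have "exp (real (card S) - L S) = exp (real (card S) * (1 - tail_const \<eta>)) / real (N (card S))"
      using N_pos[OF that] by (simp only: exp_diff[of _ "ln _"] exp_ln of_nat_0_less_iff)
    then show ?thesis by (simp only: r_def exp_of_nat_mult)
  qed
  have meas: "(\<Union>S\<in>F. E S) \<in> sets M" using E(1) assms(1) by blast
  have "prob (\<Union>S\<in>F. E S) \<le> (\<Sum>S\<in>F. prob (E S))"
    using E(1) assms(1) by (intro finite_measure_subadditive_finite) auto
  also have "\<dots> \<le> (\<Sum>S\<in>F. r ^ card S / real (N (card S)))"
    by (rule sum_mono) (use E(2) layer in auto)
  also have "\<dots> = (\<Sum>k\<in>card ` F. \<Sum>S | S \<in> F \<and> card S = k. r ^ card S / real (N (card S)))"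
    by (rule sum.image_gen[OF assms(1)])
  also have "\<dots> = (\<Sum>k\<in>card ` F. r ^ k)"
  proof (rule sum.cong[OF refl])
    fix k assume "k \<in> card ` F"
    then have "0 < N k" using N_pos by auto
    then show "(\<Sum>S | S \<in> F \<and> card S = k. r ^ card S / real (N (card S))) = r ^ k"
      by (simp add: N_def)
  qed
  also have "\<dots> \<le> r / (1 - r)"
  proof (rule sum_powers_le[OF _ _ r(1,2)])
    \<comment> \<open>All supports in \<open>F\<close> are finite and nonempty; an empty one would
      add a term \<open>r ^ 0 = 1\<close> to the series.\<close>
    show "0 \<notin> card ` F" using assms(2) by auto
  qed (use assms(1) in simp)
  also have "\<dots> = \<eta>" by (rule r(3))
  finally have "prob (space M - (\<Union>S\<in>F. E S)) \<ge> 1 - \<eta>"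
    using prob_compl[OF meas] by simp
  moreover have "\<forall>\<omega>\<in>space M - (\<Union>S\<in>F. E S). \<forall>S\<in>F. ?good S \<omega>"
    using E(3) by blast
  moreover have "space M - (\<Union>S\<in>F. E S) \<in> sets M" using meas by blast
  ultimately show ?thesis unfolding L_def N_def by blast
qed

end

subsection \<open>Restricted eigenvalues and the least squares criterion\<close>

lemma pred_norm_nonneg: "0 \<le> pred_norm n p x \<delta>"
  by (simp add: pred_norm_def emp_norm_def emp_avg_def sum_nonneg)

text \<open>Cauchy-Schwarz in each row. The crude constant shows that the Rayleigh quotients are
  bounded above, so that the supremum in \<open>phi_max\<close> is genuine.\<close>

lemma pred_norm_sq_le:
  "(pred_norm n p x \<delta>)\<^sup>2 \<le> (\<Sum>i\<in>{1..n}. \<Sum>j\<in>{1..p}. (x i j)\<^sup>2) / real n * (L2_set \<delta> {1..p})\<^sup>2"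
proof -
  have "(\<Sum>i\<in>{1..n}. (lin_pred p x \<delta> i)\<^sup>2)
      \<le> (\<Sum>i\<in>{1..n}. (\<Sum>j\<in>{1..p}. (x i j)\<^sup>2) * (\<Sum>j\<in>{1..p}. (\<delta> j)\<^sup>2))"
    unfolding lin_pred_def by (intro sum_mono Cauchy_Schwarz_ineq_sum)
  then have "(\<Sum>i\<in>{1..n}. (lin_pred p x \<delta> i)\<^sup>2) / real n
      \<le> (\<Sum>i\<in>{1..n}. (\<Sum>j\<in>{1..p}. (x i j)\<^sup>2)) * (\<Sum>j\<in>{1..p}. (\<delta> j)\<^sup>2) / real n"
    unfolding sum_distrib_right[symmetric] by (rule divide_right_mono) simp
  then show ?thesis
    by (simp add: pred_norm_def emp_norm_def emp_avg_def L2_set_def sum_nonneg)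
qed

lemma L2_set_restricted_pos:
  assumes "\<delta> \<in> restricted_directions p T m"
  shows "0 < L2_set \<delta> {1..p}"
proof -
  obtain j where "j \<in> {1..p}" "\<delta> j \<noteq> 0"
    using assms by (auto simp: restricted_directions_def)
  then have "0 < (\<Sum>j\<in>{1..p}. (\<delta> j)\<^sup>2)" by (intro sum_pos2[of _ j]) auto
  then show ?thesis by (simp add: L2_set_def)
qed

text \<open>The infimum of a nonempty bounded set is at most its supremum; without admissible
  directions both extremal values are 1 by convention.\<close>

lemma mu_ge_1:
  assumes "0 < kappa_tilde n p x T m"
  shows "1 \<le> mu n p x T m"
proof (cases "restricted_directions p T m = {}")
  case True
  then show ?thesis by (simp add: mu_def phi_max_def kappa_tilde_def)
next
  case False
  define R where "R = (\<lambda>\<delta>. (pred_norm n p x \<delta>)\<^sup>2 / (L2_set \<delta> {1..p})\<^sup>2) ` restricted_directions p T m"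
  have "bdd_above R"
    unfolding R_def
  proof (rule bdd_aboveI2)
    fix \<delta> assume "\<delta> \<in> restricted_directions p T m"
    then have "0 < (L2_set \<delta> {1..p})\<^sup>2" using L2_set_restricted_pos by force
    then show "(pred_norm n p x \<delta>)\<^sup>2 / (L2_set \<delta> {1..p})\<^sup>2
        \<le> (\<Sum>i\<in>{1..n}. \<Sum>j\<in>{1..p}. (x i j)\<^sup>2) / real n"
      using pred_norm_sq_le[of n p x \<delta>] by (simp only: pos_divide_le_eq)
  qed
  moreover have "bdd_below R" unfolding R_def by (rule bdd_belowI2[of _ 0]) simp
  moreover have "R \<noteq> {}" using False by (simp add: R_def)
  ultimately have "Inf R \<le> Sup R" by (simp add: cInf_le_cSup)
  then show ?thesis
    using assms False by (simp add: mu_def phi_max_def kappa_tilde_def R_def)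
qed

text \<open>A larger \<open>m\<close> admits more directions and so lowers the infimum. This
  transfers positivity from the selected model to \<open>m = 0\<close>, the value that occurs in the
  omission rate.\<close>

lemma kappa_tilde_antimono:
  assumes "0 < kappa_tilde n p x T m" "k \<le> m"
  shows "0 < kappa_tilde n p x T k"
proof (cases "restricted_directions p T k = {}")
  case True
  then show ?thesis by (simp add: kappa_tilde_def)
next
  case False
  have sub: "restricted_directions p T k \<subseteq> restricted_directions p T m"
    using assms(2) by (auto simp: restricted_directions_def)
  have "(INF \<delta>\<in>restricted_directions p T m. (pred_norm n p x \<delta>)\<^sup>2 / (L2_set \<delta> {1..p})\<^sup>2)
     \<le> (INF \<delta>\<in>restricted_directions p T k. (pred_norm n p x \<delta>)\<^sup>2 / (L2_set \<delta> {1..p})\<^sup>2)"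
    using False sub by (intro cINF_superset_mono bdd_belowI2[of _ 0]) auto
  moreover have "restricted_directions p T m \<noteq> {}" using False sub by blast
  ultimately show ?thesis
    using assms(1) False by (simp add: kappa_tilde_def)
qed

lemma ln_exp_mu_ge_1:
  assumes "0 < kappa_tilde n p x T m"
  shows "1 \<le> ln (exp 1 * mu n p x T m)"
  using mu_ge_1[OF assms] by (simp add: ln_mult)

section \<open>Linear predictions, the empirical norm and the criterion\<close>

lemma lin_pred_diff: "lin_pred p x (\<lambda>j. a j - b j) i = lin_pred p x a i - lin_pred p x b i"
  by (simp add: lin_pred_def algebra_simps sum_subtractf)

lemma lin_pred_eq_sum:
  assumes "S \<subseteq> {1..p}" "\<And>j. j \<in> {1..p} - S \<Longrightarrow> \<delta> j = 0"
  shows "lin_pred p x \<delta> i = (\<Sum>j\<in>S. x i j * \<delta> j)"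
  unfolding lin_pred_def using assms by (intro sum.mono_neutral_right) auto

lemma emp_norm_sq: "(emp_norm n g)\<^sup>2 = inner_on {1..n} g g / real n"
  by (simp add: emp_norm_def emp_avg_def inner_on_def sum_nonneg power2_eq_square)

lemma emp_norm_nonneg: "0 \<le> emp_norm n g"
  by (simp add: emp_norm_def emp_avg_def sum_nonneg)

lemma inner_on_le_emp_norm: "\<bar>inner_on {1..n} a b\<bar> \<le> real n * (emp_norm n a * emp_norm n b)"
proof -
  have "(inner_on {1..n} a b)\<^sup>2 \<le> inner_on {1..n} a a * inner_on {1..n} b b"
    using Cauchy_Schwarz_ineq_sum[of a b "{1..n}"] by (simp add: inner_on_def power2_eq_square)
  also have "\<dots> = (real n * (emp_norm n a * emp_norm n b))\<^sup>2"
    unfolding power_mult_distrib emp_norm_sq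
    by (cases "n = 0") (simp_all add: inner_on_def power2_eq_square)
  finally show ?thesis
    using emp_norm_nonneg[of n a] emp_norm_nonneg[of n b] by (simp add: abs_le_square_iff[symmetric])
qed

lemma emp_norm_triangle: "emp_norm n (\<lambda>i. a i + b i) \<le> emp_norm n a + emp_norm n b"
proof -
  have eq: "emp_norm n g = L2_set g {1..n} / sqrt (real n)" for g
    by (simp add: emp_norm_def emp_avg_def L2_set_def real_sqrt_divide)
  show ?thesis
    unfolding eq add_divide_distrib[symmetric] by (intro divide_right_mono L2_set_triangle_ineq) simp
qed

lemma emp_norm_minus: "emp_norm n (\<lambda>i. - g i) = emp_norm n g"
  by (simp add: emp_norm_def)

text \<open>Pointwise expansion of the squares. Splitting the response into \<open>v\<close>, later
  the regression function, and \<open>w\<close>, later the noise, separates the two cross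
  terms.\<close>

lemma mean_sq_resid_diff:
  fixes w :: "nat \<Rightarrow> real"
  shows "mean_sq_resid n p x (\<lambda>i. v i + w i) b - mean_sq_resid n p x (\<lambda>i. v i + w i) \<beta>
    = (pred_norm n p x (\<lambda>j. b j - \<beta> j))\<^sup>2
      - 2 / real n * inner_on {1..n} w (lin_pred p x (\<lambda>j. b j - \<beta> j))
      - 2 / real n * inner_on {1..n} (\<lambda>i. v i - lin_pred p x \<beta> i) (lin_pred p x (\<lambda>j. b j - \<beta> j))"
proof -
  have "(\<Sum>i\<in>{1..n}. (v i + w i - lin_pred p x b i)\<^sup>2) - (\<Sum>i\<in>{1..n}. (v i + w i - lin_pred p x \<beta> i)\<^sup>2)
    = inner_on {1..n} (lin_pred p x (\<lambda>j. b j - \<beta> j)) (lin_pred p x (\<lambda>j. b j - \<beta> j))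
      - 2 * inner_on {1..n} w (lin_pred p x (\<lambda>j. b j - \<beta> j))
      - 2 * inner_on {1..n} (\<lambda>i. v i - lin_pred p x \<beta> i) (lin_pred p x (\<lambda>j. b j - \<beta> j))"
    unfolding inner_on_def lin_pred_diff sum_distrib_left sum_subtractf[symmetric]
    by (intro sum.cong refl) (simp add: power2_eq_square algebra_simps)
  then show ?thesis
    by (simp add: mean_sq_resid_def emp_avg_def pred_norm_def emp_norm_sq diff_divide_distrib[symmetric])
qed

text \<open>If \<open>D\<close> exceeded \<open>a + sqrt b\<close>, both \<open>D\<close> and
  \<open>D - a\<close> would exceed \<open>sqrt b\<close>, and \<open>D * (D - a)\<close> would
  exceed \<open>b\<close>.\<close>

lemma le_add_sqrt_of_sq_le:
  fixes D a b :: real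
  assumes "D\<^sup>2 \<le> a * D + b" "0 \<le> a" "0 \<le> b"
  shows "D \<le> a + sqrt b"
proof (rule ccontr)
  assume "\<not> D \<le> a + sqrt b"
  then have "sqrt b < D - a" "sqrt b < D" "0 < D"
    using assms(2,3) real_sqrt_ge_zero[OF assms(3)] by linarith+
  then have "sqrt b * D < (D - a) * D" by simp
  moreover have "sqrt b * sqrt b \<le> sqrt b * D"
    by (rule mult_left_mono) (use \<open>sqrt b < D\<close> assms(3) in auto)
  moreover have "(D - a) * D \<le> b" using assms(1) by (simp add: power2_eq_square algebra_simps)
  ultimately show False using assms(3) by simp
qed

subsection \<open>Bounds on the selection gaps and on the estimation error\<close>

text \<open>The estimators need not be measurable, so the set where \<open>Q\<close> holds need not
  be an event. Removing a measurable null set from \<open>E\<close> avoids it.\<close>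

lemma (in prob_space) AE_holds_on_event:
  assumes "AE \<omega> in M. Q \<omega>" "E \<in> sets M"
  shows "\<exists>A\<in>sets M. prob A = prob E \<and> A \<subseteq> E \<and> (\<forall>\<omega>\<in>A. Q \<omega>)"
proof -
  obtain N where N: "{\<omega>\<in>space M. \<not> Q \<omega>} \<subseteq> N" "N \<in> null_sets M"
    using AE_E[OF assms(1)] by (metis null_setsI)
  have "prob (E - N) = prob E" using measure_Diff_null_set[OF assms(2) N(2)] .
  moreover have "E - N \<in> sets M" using N(2) assms(2) by auto
  moreover have "\<forall>\<omega>\<in>E - N. Q \<omega>" using N(1) sets.sets_into_space[OF assms(2)] by blast
  ultimately show ?thesis by blast
qed

context gaussian_regression
begin

section \<open>Notation, and the approximation error of the oracle\<close>

abbreviation "regr \<equiv> (\<lambda>i. P (z i))"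
abbreviation "fval \<equiv> (\<lambda>i. f (z i))"
abbreviation "resp \<equiv> (\<lambda>\<omega> i. f (z i) + u i \<omega>)"
abbreviation "crit \<omega> \<equiv> mean_sq_resid n p regr (resp \<omega>)"
abbreviation "s\<^sub>0 \<equiv> oracle_s n p regr fval \<sigma>"
abbreviation "c\<^sub>0 \<equiv> oracle_c n p regr fval s\<^sub>0"
abbreviation "T\<^sub>0 \<equiv> support p \<beta>\<^sub>0"
abbreviation "selection_rate m \<equiv>
  sqrt ((real m * ln (real p) + (real m + real s\<^sub>0) * ln (exp 1 * mu n p regr T\<^sub>0 m)) / real n)"
abbreviation "omission_rate k \<equiv>
  sqrt ((ln (real (s\<^sub>0 choose k)) + real k * ln (exp 1 * mu n p regr T\<^sub>0 0)) / real n)"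

lemma card_support_le: "card T\<^sub>0 \<le> s\<^sub>0"
  using beta0_minimizer by (simp add: is_arg_min_def l0_norm_def)

lemma support_subset: "T\<^sub>0 \<subseteq> {1..p}"
  by (auto simp: support_def)

text \<open>The infimum that defines the oracle error is attained at
  \<open>\<beta>\<^sub>0\<close>.\<close>

lemma oracle_c_eq: "c\<^sub>0 = emp_norm n (\<lambda>i. f (z i) - lin_pred p regr \<beta>\<^sub>0 i)"
proof -
  have "(INF \<beta>\<in>{\<beta>. l0_norm p \<beta> \<le> s\<^sub>0}. mean_sq_resid n p regr fval \<beta>) = mean_sq_resid n p regr fval \<beta>\<^sub>0"
    using beta0_minimizer by (intro cInf_eq_minimum) (auto simp: is_arg_min_def not_less)
  then show ?thesis by (simp add: oracle_c_def emp_norm_def mean_sq_resid_def)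
qed

text \<open>A deterministic statement: the noise enters only through the assumed level
  \<open>L\<close>. It is two-sided because the upper half bounds the gaps and the lower half
  controls the error of the post-selection estimator.\<close>

lemma crit_diff_bound:
  fixes b :: "nat \<Rightarrow> real"
  defines "d \<equiv> (\<lambda>j. b j - \<beta>\<^sub>0 j)"
  assumes noise: "(inner_on {1..n} (\<lambda>i. u i \<omega>) (lin_pred p regr d))\<^sup>2
      \<le> 4 * \<sigma>\<^sup>2 * L * inner_on {1..n} (lin_pred p regr d) (lin_pred p regr d)"
    and L: "0 \<le> L" "sqrt (L / real n) \<le> r"
  shows "\<bar>crit \<omega> b - crit \<omega> \<beta>\<^sub>0 - (pred_norm n p regr d)\<^sup>2\<bar> \<le> (4 * \<sigma> * r + 2 * c\<^sub>0) * pred_norm n p regr d"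
proof -
  let ?D = "pred_norm n p regr d"
  let ?W = "inner_on {1..n} (\<lambda>i. u i \<omega>) (lin_pred p regr d)"
  let ?R = "inner_on {1..n} (\<lambda>i. f (z i) - lin_pred p regr \<beta>\<^sub>0 i) (lin_pred p regr d)"
  have n: "0 < real n" using n_pos by simp
  have D: "0 \<le> ?D" by (rule pred_norm_nonneg)
  have "inner_on {1..n} (lin_pred p regr d) (lin_pred p regr d) = real n * ?D\<^sup>2"
    using n by (simp add: pred_norm_def emp_norm_sq)
  with noise have "?W\<^sup>2 \<le> 4 * \<sigma>\<^sup>2 * L * (real n * ?D\<^sup>2)" by simp
  \<comment> \<open>Written as a square in order to take roots; the factor \<open>2 / real n\<close>
    of the cross term then produces the constant \<open>4 * \<sigma> * r\<close>.\<close>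
  also have "\<dots> = (2 * \<sigma> * (real n * sqrt (L / real n)) * ?D)\<^sup>2"
    using L(1) n by (simp add: power_mult_distrib power2_eq_square[of "real n"])
  finally have "\<bar>?W\<bar> \<le> \<bar>2 * \<sigma> * (real n * sqrt (L / real n)) * ?D\<bar>"
    by (simp only: abs_le_square_iff)
  also have "\<dots> = 2 * \<sigma> * (real n * sqrt (L / real n)) * ?D"
    using sigma_pos n L(1) D by (intro abs_of_nonneg) simp
  also have "\<dots> \<le> 2 * \<sigma> * (real n * r) * ?D"
    using sigma_pos n L(2) D by (intro mult_right_mono mult_left_mono) auto
  finally have "2 / real n * \<bar>?W\<bar> \<le> 2 / real n * (2 * \<sigma> * (real n * r) * ?D)"
    by (rule mult_left_mono) simp
  then have W: "\<bar>2 / real n * ?W\<bar> \<le> 4 * \<sigma> * r * ?D"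
    using n by (simp add: abs_mult)
  have "2 / real n * \<bar>?R\<bar> \<le> 2 / real n * (real n * (c\<^sub>0 * ?D))"
    using inner_on_le_emp_norm[of n "\<lambda>i. f (z i) - lin_pred p regr \<beta>\<^sub>0 i" "lin_pred p regr d"]
    by (intro mult_left_mono) (simp_all add: oracle_c_eq pred_norm_def)
  then have R: "\<bar>2 / real n * ?R\<bar> \<le> 2 * c\<^sub>0 * ?D"
    using n by (simp add: abs_mult)
  have "crit \<omega> b - crit \<omega> \<beta>\<^sub>0 - ?D\<^sup>2 = - (2 / real n * ?W) - 2 / real n * ?R"
    using mean_sq_resid_diff[of n p regr fval "\<lambda>i. u i \<omega>" b \<beta>\<^sub>0] unfolding d_def by linarith
  then show ?thesis
    using W R unfolding distrib_right by linarith
qed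

text \<open>A vector supported in \<open>Th\<close> differs from \<open>\<beta>\<^sub>0\<close> only
  on \<open>T\<^sub>0 \<union> Th\<close>. The union bound runs over supersets of
  \<open>T\<^sub>0\<close>, of which at most \<open>p ^ m\<close> have the given size, and it is
  uniform in \<open>Th\<close>, so the model may depend on the data.\<close>

lemma selection_bound:
  assumes "0 < \<eta>"
  shows "\<exists>E\<in>sets M. prob E \<ge> 1 - \<eta> \<and> (\<forall>\<omega>\<in>E. \<forall>Th b. Th \<subseteq> {1..p} \<longrightarrow> (\<forall>j\<in>{1..p} - Th. b j = 0) \<longrightarrow>
     0 < kappa_tilde n p regr T\<^sub>0 (card (Th - T\<^sub>0)) \<longrightarrow>
     \<bar>crit \<omega> b - crit \<omega> \<beta>\<^sub>0 - (pred_norm n p regr (\<lambda>j. b j - \<beta>\<^sub>0 j))\<^sup>2\<bar>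
     \<le> (4 * sqrt (tail_const \<eta>) * \<sigma> * selection_rate (card (Th - T\<^sub>0)) + 2 * c\<^sub>0)
        * pred_norm n p regr (\<lambda>j. b j - \<beta>\<^sub>0 j))"
proof -
  define F where "F = {S. T\<^sub>0 \<subseteq> S \<and> S \<subseteq> {1..p} \<and> S \<noteq> {}}"
  have fin: "finite F" by (rule finite_subset[of _ "Pow {1..p}"]) (auto simp: F_def)
  have F: "\<forall>S\<in>F. finite S \<and> S \<noteq> {}"
    by (auto simp: F_def intro: finite_subset)
  obtain E where E: "E \<in> sets M" "prob E \<ge> 1 - \<eta>" "\<forall>\<omega>\<in>E. \<forall>S\<in>F. \<forall>\<delta>.
     (inner_on {1..n} (\<lambda>i. u i \<omega>) (\<lambda>i. \<Sum>j\<in>S. regr i j * \<delta> j))\<^sup>2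
     \<le> 4 * \<sigma>\<^sup>2 * (ln (real (card {S'\<in>F. card S' = card S})) + tail_const \<eta> * real (card S))
        * inner_on {1..n} (\<lambda>i. \<Sum>j\<in>S. regr i j * \<delta> j) (\<lambda>i. \<Sum>j\<in>S. regr i j * \<delta> j)"
    using noise_uniform_bound[OF fin F assms, of regr] by (elim bexE conjE) (rule that; assumption)
  have "\<bar>crit \<omega> b - crit \<omega> \<beta>\<^sub>0 - (pred_norm n p regr (\<lambda>j. b j - \<beta>\<^sub>0 j))\<^sup>2\<bar>
     \<le> (4 * sqrt (tail_const \<eta>) * \<sigma> * selection_rate (card (Th - T\<^sub>0)) + 2 * c\<^sub>0)
        * pred_norm n p regr (\<lambda>j. b j - \<beta>\<^sub>0 j)"
    if \<omega>: "\<omega> \<in> E" and Th: "Th \<subseteq> {1..p}" and b: "\<forall>j\<in>{1..p} - Th. b j = 0"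
      and \<kappa>: "0 < kappa_tilde n p regr T\<^sub>0 (card (Th - T\<^sub>0))" for \<omega> Th b
  proof -
    define m where "m = card (Th - T\<^sub>0)"
    define S where "S = T\<^sub>0 \<union> Th"
    define lmu where "lmu = ln (exp 1 * mu n p regr T\<^sub>0 m)"
    define rate where "rate = real m * ln (real p) + (real m + real s\<^sub>0) * lmu"
    have lmu: "1 \<le> lmu" unfolding lmu_def m_def by (rule ln_exp_mu_ge_1[OF \<kappa>])
    have tc: "1 \<le> tail_const \<eta>" by (rule tail_const_ge_1[OF assms])
    have lnp: "0 \<le> ln (real p)" using p_pos by simp
    have S_sub: "S \<subseteq> {1..p}" using Th support_subset by (auto simp: S_def)
    have lp: "lin_pred p regr (\<lambda>j. b j - \<beta>\<^sub>0 j) = (\<lambda>i. \<Sum>j\<in>S. regr i j * (b j - \<beta>\<^sub>0 j))"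
      by (rule ext, rule lin_pred_eq_sum[OF S_sub]) (use b in \<open>auto simp: S_def support_def\<close>)
    \<comment> \<open>For empty \<open>S\<close> the prediction difference is zero, so level 0 is
      enough; the union bound covers only nonempty supports.\<close>
    define L where "L = (if S = {} then 0
      else ln (real (card {S'\<in>F. card S' = card S})) + tail_const \<eta> * real (card S))"
    have noise: "(inner_on {1..n} (\<lambda>i. u i \<omega>) (lin_pred p regr (\<lambda>j. b j - \<beta>\<^sub>0 j)))\<^sup>2
      \<le> 4 * \<sigma>\<^sup>2 * L * inner_on {1..n} (lin_pred p regr (\<lambda>j. b j - \<beta>\<^sub>0 j)) (lin_pred p regr (\<lambda>j. b j - \<beta>\<^sub>0 j))"
    proof (cases "S = {}")
      case True
      then show ?thesis unfolding lp by (simp add: inner_on_def)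
    next
      case False
      then have "S \<in> F" using S_sub by (auto simp: F_def S_def)
      from E(3)[rule_format, OF \<omega> this, of "\<lambda>j. b j - \<beta>\<^sub>0 j"] False show ?thesis
        unfolding lp by (simp add: L_def)
    qed
    have "0 \<le> L \<and> L \<le> tail_const \<eta> * rate"
    proof (cases "S = {}")
      case True
      then show ?thesis using tc lnp lmu by (simp add: L_def rate_def)
    next
      case False
      let ?N = "{S'\<in>F. card S' = card S}"
      have "S \<in> ?N" using S_sub False by (auto simp: F_def S_def)
      then have N_pos: "1 \<le> card ?N" using fin by (auto simp: Suc_le_eq card_gt_0_iff)
      have fT: "finite T\<^sub>0" using support_subset finite_subset by blast
      have card_S: "card S = card T\<^sub>0 + m"
      proof -
        have "S = T\<^sub>0 \<union> (Th - T\<^sub>0)" by (auto simp: S_def)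
        moreover have "finite (Th - T\<^sub>0)" using Th finite_subset by blast
        ultimately show ?thesis unfolding m_def using fT by (simp only:) (subst card_Un_disjoint; auto)
      qed
      have "m \<le> p"
        unfolding m_def using card_mono[of "{1..p}" "Th - T\<^sub>0"] Th by auto
      \<comment> \<open>A superset of \<open>T\<^sub>0\<close> is determined by its part outside
        \<open>T\<^sub>0\<close>, which has \<open>m\<close> elements.\<close>
      have "card ?N \<le> card {A. A \<subseteq> {1..p} \<and> card A = m}"
      proof (rule card_inj_on_le[of "\<lambda>S'. S' - T\<^sub>0"])
        show "inj_on (\<lambda>S'. S' - T\<^sub>0) ?N" by (auto simp: inj_on_def F_def)
        show "(\<lambda>S'. S' - T\<^sub>0) ` ?N \<subseteq> {A. A \<subseteq> {1..p} \<and> card A = m}"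
          using fT card_S by (auto simp: F_def card_Diff_subset)
        show "finite {A. A \<subseteq> {1..p} \<and> card A = m}"
          by (rule finite_subset[of _ "Pow {1..p}"]) auto
      qed
      also have "\<dots> = p choose m" by (simp add: n_subsets)
      also have "\<dots> \<le> p ^ m" using \<open>m \<le> p\<close> by (rule binomial_le_pow)
      finally have "real (card ?N) \<le> real p ^ m" by (metis of_nat_le_iff of_nat_power)
      then have "ln (real (card ?N)) \<le> ln (real p ^ m)"
        using N_pos p_pos by (intro ln_mono) auto
      also have "\<dots> = real m * ln (real p)" using p_pos by (simp add: ln_realpow)
      \<comment> \<open>As \<open>tail_const \<eta>\<close> is at least 1, the counting term can
        carry the same constant as the dimension term.\<close>
      also have "\<dots> \<le> tail_const \<eta> * (real m * ln (real p))"
        using mult_right_mono[OF tc, of "real m * ln (real p)"] lnp by simp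
      finally have ln_N: "ln (real (card ?N)) \<le> tail_const \<eta> * (real m * ln (real p))" .
      \<comment> \<open>Here \<open>lmu \<ge> 1\<close> absorbs the dimension of the span.\<close>
      have "real (card S) * 1 \<le> (real m + real s\<^sub>0) * lmu"
        using card_S card_support_le lmu by (intro mult_mono) auto
      then have "tail_const \<eta> * real (card S) \<le> tail_const \<eta> * ((real m + real s\<^sub>0) * lmu)"
        using tc by (intro mult_left_mono) auto
      with ln_N have "L \<le> tail_const \<eta> * rate"
        using False by (simp add: L_def rate_def distrib_left)
      moreover have "0 \<le> L" using False N_pos tc by (simp add: L_def)
      ultimately show ?thesis by blast
    qed
    then have L: "0 \<le> L" "sqrt (L / real n) \<le> sqrt (tail_const \<eta>) * sqrt (rate / real n)"
      by (auto simp flip: real_sqrt_mult intro!: divide_right_mono)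
    show ?thesis
      using crit_diff_bound[OF noise L] by (simp add: rate_def lmu_def m_def mult_ac)
  qed
  with E(1,2) show ?thesis by blast
qed

text \<open>Restricting \<open>\<beta>\<^sub>0\<close> to \<open>Th\<close> changes it only on
  \<open>T\<^sub>0 - Th\<close>. The union bound therefore runs over subsets of
  \<open>T\<^sub>0\<close>, and binomial coefficients replace powers of \<open>p\<close>.\<close>

lemma omission_bound:
  assumes "0 < \<eta>"
  shows "\<exists>E\<in>sets M. prob E \<ge> 1 - \<eta> \<and> (\<forall>\<omega>\<in>E. \<forall>Th. \<not> T\<^sub>0 \<subseteq> Th \<longrightarrow> 0 < kappa_tilde n p regr T\<^sub>0 0 \<longrightarrow>
     crit \<omega> (vec_restrict Th \<beta>\<^sub>0) - crit \<omega> \<beta>\<^sub>0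
     \<le> (pred_norm n p regr (vec_restrict ({1..p} - Th) \<beta>\<^sub>0))\<^sup>2
       + (4 * sqrt (tail_const \<eta>) * \<sigma> * omission_rate (card (T\<^sub>0 - Th)) + 2 * c\<^sub>0)
        * pred_norm n p regr (vec_restrict ({1..p} - Th) \<beta>\<^sub>0))"
proof -
  define F where "F = {S. S \<subseteq> T\<^sub>0 \<and> S \<noteq> {}}"
  have fT: "finite T\<^sub>0" using support_subset finite_subset by blast
  have fin: "finite F" by (rule finite_subset[of _ "Pow T\<^sub>0"]) (auto simp: F_def fT)
  have F: "\<forall>S\<in>F. finite S \<and> S \<noteq> {}"
    using fT by (auto simp: F_def intro: finite_subset)
  obtain E where E: "E \<in> sets M" "prob E \<ge> 1 - \<eta>" "\<forall>\<omega>\<in>E. \<forall>S\<in>F. \<forall>\<delta>.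
     (inner_on {1..n} (\<lambda>i. u i \<omega>) (\<lambda>i. \<Sum>j\<in>S. regr i j * \<delta> j))\<^sup>2
     \<le> 4 * \<sigma>\<^sup>2 * (ln (real (card {S'\<in>F. card S' = card S})) + tail_const \<eta> * real (card S))
        * inner_on {1..n} (\<lambda>i. \<Sum>j\<in>S. regr i j * \<delta> j) (\<lambda>i. \<Sum>j\<in>S. regr i j * \<delta> j)"
    using noise_uniform_bound[OF fin F assms, of regr] by (elim bexE conjE) (rule that; assumption)
  have "crit \<omega> (vec_restrict Th \<beta>\<^sub>0) - crit \<omega> \<beta>\<^sub>0
     \<le> (pred_norm n p regr (vec_restrict ({1..p} - Th) \<beta>\<^sub>0))\<^sup>2
       + (4 * sqrt (tail_const \<eta>) * \<sigma> * omission_rate (card (T\<^sub>0 - Th)) + 2 * c\<^sub>0)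
        * pred_norm n p regr (vec_restrict ({1..p} - Th) \<beta>\<^sub>0)"
    if \<omega>: "\<omega> \<in> E" and Th: "\<not> T\<^sub>0 \<subseteq> Th" and \<kappa>: "0 < kappa_tilde n p regr T\<^sub>0 0" for \<omega> Th
  proof -
    define S where "S = T\<^sub>0 - Th"
    define k where "k = card S"
    define lmu where "lmu = ln (exp 1 * mu n p regr T\<^sub>0 0)"
    define rate where "rate = ln (real (s\<^sub>0 choose k)) + real k * lmu"
    define d where "d = (\<lambda>j. vec_restrict Th \<beta>\<^sub>0 j - \<beta>\<^sub>0 j)"
    define N where "N = {S'\<in>F. card S' = card S}"
    define L where "L = ln (real (card N)) + tail_const \<eta> * real (card S)"
    have lmu: "1 \<le> lmu" unfolding lmu_def by (rule ln_exp_mu_ge_1[OF \<kappa>])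
    have tc: "1 \<le> tail_const \<eta>" by (rule tail_const_ge_1[OF assms])
    have S_F: "S \<in> F" using Th by (auto simp: F_def S_def)
    have S_sub: "S \<subseteq> {1..p}" using support_subset by (auto simp: S_def)
    have lp: "lin_pred p regr d = (\<lambda>i. \<Sum>j\<in>S. regr i j * d j)"
      by (rule ext, rule lin_pred_eq_sum[OF S_sub]) (auto simp: S_def support_def d_def vec_restrict_def)
    have noise: "(inner_on {1..n} (\<lambda>i. u i \<omega>) (lin_pred p regr d))\<^sup>2
      \<le> 4 * \<sigma>\<^sup>2 * L * inner_on {1..n} (lin_pred p regr d) (lin_pred p regr d)"
      unfolding lp L_def N_def by (rule E(3)[rule_format, OF \<omega> S_F])
    have "S \<in> N" using S_F by (simp add: N_def)
    then have N_pos: "1 \<le> card N" using fin by (auto simp: Suc_le_eq card_gt_0_iff N_def)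
    have "card N \<le> card {A. A \<subseteq> T\<^sub>0 \<and> card A = k}"
      using fT by (intro card_mono) (auto simp: N_def F_def k_def)
    also have "\<dots> = card T\<^sub>0 choose k" by (simp add: n_subsets fT)
    also have "\<dots> \<le> s\<^sub>0 choose k" by (rule binomial_right_mono[OF card_support_le])
    finally have "ln (real (card N)) \<le> ln (real (s\<^sub>0 choose k))"
      using N_pos by (intro ln_mono) auto
    \<comment> \<open>Together with the preceding inequality this makes the logarithm of the
      binomial coefficient nonnegative, as needed to multiply it by a constant that is at least
      1.\<close>
    moreover have "0 \<le> ln (real (card N))" using N_pos by simp
    ultimately have ln_N: "ln (real (card N)) \<le> tail_const \<eta> * ln (real (s\<^sub>0 choose k))"
      using mult_right_mono[OF tc, of "ln (real (s\<^sub>0 choose k))"] by simp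
    have "real k * 1 \<le> real k * lmu" using lmu by (intro mult_left_mono) auto
    then have "tail_const \<eta> * real k \<le> tail_const \<eta> * (real k * lmu)"
      using tc by (intro mult_left_mono) auto
    with ln_N have "L \<le> tail_const \<eta> * rate"
      by (simp add: L_def rate_def distrib_left k_def)
    moreover have L0: "0 \<le> L" using N_pos tc by (simp add: L_def)
    ultimately have L: "sqrt (L / real n) \<le> sqrt (tail_const \<eta>) * sqrt (rate / real n)"
      by (auto simp flip: real_sqrt_mult intro!: divide_right_mono)
    \<comment> \<open>The difference is minus the omitted part of \<open>\<beta>\<^sub>0\<close>;
      the sign disappears in the norm.\<close>
    have "lin_pred p regr d = (\<lambda>i. - lin_pred p regr (vec_restrict ({1..p} - Th) \<beta>\<^sub>0) i)"
      unfolding lin_pred_def sum_negf[symmetric]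
      by (intro ext sum.cong) (auto simp: d_def vec_restrict_def)
    then have d_norm: "pred_norm n p regr d = pred_norm n p regr (vec_restrict ({1..p} - Th) \<beta>\<^sub>0)"
      by (simp add: pred_norm_def emp_norm_minus)
    show ?thesis
      using crit_diff_bound[OF noise[unfolded d_def] L0 L] unfolding d_def[symmetric] d_norm
      by (simp add: rate_def lmu_def k_def S_def mult_ac)
  qed
  with E(1,2) show ?thesis by blast
qed

text \<open>Both \<open>h\<close> and the restriction of \<open>\<beta>\<^sub>0\<close> to the
  support of \<open>h\<close> are feasible, so the optimum is below both and its gap is at most the
  minimum of theirs. Solving the quadratic inequality gives \<open>2 * c\<^sub>0\<close>, and the
  triangle inequality from \<open>\<beta>\<^sub>0\<close> to \<open>f\<close> adds the third
  \<open>c\<^sub>0\<close>.\<close>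

lemma post_selection_error_le:
  assumes "post_selection_ls n p regr (resp \<omega>) (support p h) b"
    and "\<bar>crit \<omega> b - crit \<omega> \<beta>\<^sub>0 - (pred_norm n p regr (\<lambda>j. b j - \<beta>\<^sub>0 j))\<^sup>2\<bar>
      \<le> (r + 2 * c\<^sub>0) * pred_norm n p regr (\<lambda>j. b j - \<beta>\<^sub>0 j)" and "0 \<le> r"
  shows "emp_norm n (\<lambda>i. lin_pred p regr b i - f (z i)) \<le> r + 3 * c\<^sub>0
    + sqrt (min (max (crit \<omega> h - crit \<omega> \<beta>\<^sub>0) 0)
                (max (crit \<omega> (vec_restrict (support p h) \<beta>\<^sub>0) - crit \<omega> \<beta>\<^sub>0) 0))"
    (is "_ \<le> _ + sqrt ?m")
proof -
  let ?D = "pred_norm n p regr (\<lambda>j. b j - \<beta>\<^sub>0 j)"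
  have c: "0 \<le> c\<^sub>0" unfolding oracle_c_eq by (rule emp_norm_nonneg)
  have min: "crit \<omega> b \<le> crit \<omega> b'" if "\<forall>j\<in>{1..p} - support p h. b' j = 0" for b'
    using assms(1) that by (auto simp: post_selection_ls_def is_arg_min_def not_less)
  have "crit \<omega> b \<le> crit \<omega> h" by (rule min) (auto simp: support_def)
  moreover have "crit \<omega> b \<le> crit \<omega> (vec_restrict (support p h) \<beta>\<^sub>0)"
    by (rule min) (auto simp: vec_restrict_def)
  ultimately have "crit \<omega> b - crit \<omega> \<beta>\<^sub>0 \<le> ?m" by linarith
  then have "?D\<^sup>2 \<le> (r + 2 * c\<^sub>0) * ?D + ?m" using assms(2) by linarith
  then have D: "?D \<le> r + 2 * c\<^sub>0 + sqrt ?m"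
    by (rule le_add_sqrt_of_sq_le) (use assms(3) c in auto)
  have "emp_norm n (\<lambda>i. lin_pred p regr b i - f (z i))
     = emp_norm n (\<lambda>i. lin_pred p regr (\<lambda>j. b j - \<beta>\<^sub>0 j) i + - (f (z i) - lin_pred p regr \<beta>\<^sub>0 i))"
    by (simp add: lin_pred_diff)
  also have "\<dots> \<le> ?D + c\<^sub>0"
    unfolding pred_norm_def oracle_c_eq
    by (rule order_trans[OF emp_norm_triangle]) (simp only: emp_norm_minus order_refl)
  finally show ?thesis using D by linarith
qed

section \<open>Probability statements for the selected model\<close>

lemma selection_rate_nonneg:
  assumes "0 < kappa_tilde n p regr T\<^sub>0 m"
  shows "0 \<le> selection_rate m"
proof -
  have "0 \<le> ln (exp 1 * mu n p regr T\<^sub>0 m)" using ln_exp_mu_ge_1[OF assms] by linarith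
  moreover have "0 \<le> ln (real p)" using p_pos by simp
  ultimately show ?thesis by simp
qed

text \<open>The good event concerns the noise alone and is uniform over models, so the random
  support and estimator can be inserted pointwise, off a null set where the hypotheses may
  fail.\<close>

lemma post_selection_rate:
  assumes "0 < \<eta>"
    and adm: "admissible_selector M n p regr \<beta>\<^sub>0 bh"
    and post: "AE \<omega> in M. post_selection_ls n p regr (resp \<omega>) (support p (bh \<omega>)) (bt \<omega>)"
  shows "\<exists>A\<in>sets M. prob A \<ge> 1 - \<eta> \<and> (\<forall>\<omega>\<in>A.
    emp_norm n (\<lambda>i. lin_pred p regr (bt \<omega>) i - f (z i))
      \<le> 4 * sqrt (tail_const \<eta>) * \<sigma> * selection_rate (card (support p (bh \<omega>) - T\<^sub>0)) + 3 * c\<^sub>0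
        + sqrt (min (max (crit \<omega> (bh \<omega>) - crit \<omega> \<beta>\<^sub>0) 0)
            (max (crit \<omega> (vec_restrict (support p (bh \<omega>)) \<beta>\<^sub>0) - crit \<omega> \<beta>\<^sub>0) 0)))"
proof -
  let ?Q = "\<lambda>\<omega>. post_selection_ls n p regr (resp \<omega>) (support p (bh \<omega>)) (bt \<omega>) \<and>
    0 < kappa_tilde n p regr T\<^sub>0 (card (support p (bh \<omega>) - T\<^sub>0))"
  obtain E where E: "E \<in> sets M" "prob E \<ge> 1 - \<eta>" "\<forall>\<omega>\<in>E. \<forall>Th b. Th \<subseteq> {1..p} \<longrightarrow>
     (\<forall>j\<in>{1..p} - Th. b j = 0) \<longrightarrow> 0 < kappa_tilde n p regr T\<^sub>0 (card (Th - T\<^sub>0)) \<longrightarrow>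
     \<bar>crit \<omega> b - crit \<omega> \<beta>\<^sub>0 - (pred_norm n p regr (\<lambda>j. b j - \<beta>\<^sub>0 j))\<^sup>2\<bar>
     \<le> (4 * sqrt (tail_const \<eta>) * \<sigma> * selection_rate (card (Th - T\<^sub>0)) + 2 * c\<^sub>0)
        * pred_norm n p regr (\<lambda>j. b j - \<beta>\<^sub>0 j)"
    using selection_bound[OF \<open>0 < \<eta>\<close>] by (elim bexE conjE) (rule that; assumption)
  have "AE \<omega> in M. ?Q \<omega>"
    using post adm unfolding admissible_selector_def by eventually_elim blast
  from AE_holds_on_event[OF this E(1)] obtain A where
    A: "A \<in> sets M" "prob A = prob E" "A \<subseteq> E" "\<And>\<omega>. \<omega> \<in> A \<Longrightarrow> ?Q \<omega>" by blast
  show ?thesis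
  proof (intro bexI[OF _ A(1)] conjI ballI)
    show "prob A \<ge> 1 - \<eta>" using A(2) E(2) by simp
    fix \<omega> assume \<omega>: "\<omega> \<in> A"
    let ?Th = "support p (bh \<omega>)"
    have Th: "?Th \<subseteq> {1..p}" by (auto simp: support_def)
    have bt: "\<forall>j\<in>{1..p} - ?Th. bt \<omega> j = 0"
      using A(4)[OF \<omega>] by (simp add: post_selection_ls_def is_arg_min_def)
    have \<kappa>: "0 < kappa_tilde n p regr T\<^sub>0 (card (?Th - T\<^sub>0))" using A(4)[OF \<omega>] by blast
    have "0 \<le> 4 * sqrt (tail_const \<eta>) * \<sigma> * selection_rate (card (?Th - T\<^sub>0))"
      using selection_rate_nonneg[OF \<kappa>] sigma_pos tail_const_ge_1[OF \<open>0 < \<eta>\<close>] by (intro mult_nonneg_nonneg) auto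
    then show "emp_norm n (\<lambda>i. lin_pred p regr (bt \<omega>) i - f (z i))
      \<le> 4 * sqrt (tail_const \<eta>) * \<sigma> * selection_rate (card (?Th - T\<^sub>0)) + 3 * c\<^sub>0
        + sqrt (min (max (crit \<omega> (bh \<omega>) - crit \<omega> \<beta>\<^sub>0) 0)
            (max (crit \<omega> (vec_restrict ?Th \<beta>\<^sub>0) - crit \<omega> \<beta>\<^sub>0) 0))"
      using A(3,4) \<omega> E(3)[rule_format, OF _ Th bt[rule_format] \<kappa>]
      by (intro post_selection_error_le) auto
  qed
qed

text \<open>The two gaps are controlled on separate events, each given half of
  \<open>\<eta>\<close>, and then on their intersection.\<close>

lemma selection_gaps:
  assumes "0 < \<eta>" and adm: "admissible_selector M n p regr \<beta>\<^sub>0 bh"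
  shows "\<exists>A\<in>sets M. prob A \<ge> 1 - \<eta> \<and> (\<forall>\<omega>\<in>A.
    crit \<omega> (bh \<omega>) - crit \<omega> \<beta>\<^sub>0 \<le> (pred_norm n p regr (\<lambda>j. bh \<omega> j - \<beta>\<^sub>0 j))\<^sup>2
      + (4 * sqrt (tail_const (\<eta> / 2)) * \<sigma> * selection_rate (card (support p (bh \<omega>) - T\<^sub>0)) + 2 * c\<^sub>0)
        * pred_norm n p regr (\<lambda>j. bh \<omega> j - \<beta>\<^sub>0 j) \<and>
    crit \<omega> (vec_restrict (support p (bh \<omega>)) \<beta>\<^sub>0) - crit \<omega> \<beta>\<^sub>0
      \<le> of_bool (\<not> T\<^sub>0 \<subseteq> support p (bh \<omega>)) *
        ((pred_norm n p regr (vec_restrict ({1..p} - support p (bh \<omega>)) \<beta>\<^sub>0))\<^sup>2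
         + (4 * sqrt (tail_const (\<eta> / 2)) * \<sigma> * omission_rate (card (T\<^sub>0 - support p (bh \<omega>))) + 2 * c\<^sub>0)
           * pred_norm n p regr (vec_restrict ({1..p} - support p (bh \<omega>)) \<beta>\<^sub>0)))"
proof -
  let ?Q = "\<lambda>\<omega>. 0 < kappa_tilde n p regr T\<^sub>0 (card (support p (bh \<omega>) - T\<^sub>0))"
  have half: "0 < \<eta> / 2" using assms(1) by simp
  obtain E1 where E1: "E1 \<in> sets M" "prob E1 \<ge> 1 - \<eta> / 2" "\<forall>\<omega>\<in>E1. \<forall>Th b. Th \<subseteq> {1..p} \<longrightarrow>
     (\<forall>j\<in>{1..p} - Th. b j = 0) \<longrightarrow> 0 < kappa_tilde n p regr T\<^sub>0 (card (Th - T\<^sub>0)) \<longrightarrow>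
     \<bar>crit \<omega> b - crit \<omega> \<beta>\<^sub>0 - (pred_norm n p regr (\<lambda>j. b j - \<beta>\<^sub>0 j))\<^sup>2\<bar>
     \<le> (4 * sqrt (tail_const (\<eta> / 2)) * \<sigma> * selection_rate (card (Th - T\<^sub>0)) + 2 * c\<^sub>0)
        * pred_norm n p regr (\<lambda>j. b j - \<beta>\<^sub>0 j)"
    using selection_bound[OF half] by (elim bexE conjE) (rule that; assumption)
  obtain E2 where E2: "E2 \<in> sets M" "prob E2 \<ge> 1 - \<eta> / 2" "\<forall>\<omega>\<in>E2. \<forall>Th. \<not> T\<^sub>0 \<subseteq> Th \<longrightarrow> 0 < kappa_tilde n p regr T\<^sub>0 0 \<longrightarrow>
     crit \<omega> (vec_restrict Th \<beta>\<^sub>0) - crit \<omega> \<beta>\<^sub>0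
     \<le> (pred_norm n p regr (vec_restrict ({1..p} - Th) \<beta>\<^sub>0))\<^sup>2
       + (4 * sqrt (tail_const (\<eta> / 2)) * \<sigma> * omission_rate (card (T\<^sub>0 - Th)) + 2 * c\<^sub>0)
        * pred_norm n p regr (vec_restrict ({1..p} - Th) \<beta>\<^sub>0)"
    using omission_bound[OF half] by (elim bexE conjE) (rule that; assumption)
  have "prob (E1 \<inter> E2) \<ge> 1 - \<eta>"
  proof -
    have "prob (E1 \<union> E2) = prob E1 + prob E2 - prob (E1 \<inter> E2)"
      using E1(1) E2(1) by (simp add: measure_Un3 fmeasurable_eq_sets)
    then show ?thesis using E1(2) E2(2) prob_le_1[of "E1 \<union> E2"] by linarith
  qed
  have "AE \<omega> in M. ?Q \<omega>"
    using adm unfolding admissible_selector_def by eventually_elim blast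
  from AE_holds_on_event[OF this, of "E1 \<inter> E2"] E1(1) E2(1) obtain A where
    A: "A \<in> sets M" "prob A = prob (E1 \<inter> E2)" "A \<subseteq> E1 \<inter> E2" "\<And>\<omega>. \<omega> \<in> A \<Longrightarrow> ?Q \<omega>" by blast
  show ?thesis
  proof (intro bexI[OF _ A(1)] conjI ballI)
    show "prob A \<ge> 1 - \<eta>" using A(2) \<open>prob (E1 \<inter> E2) \<ge> 1 - \<eta>\<close> by simp
    fix \<omega> assume \<omega>: "\<omega> \<in> A"
    let ?Th = "support p (bh \<omega>)"
    have Th: "?Th \<subseteq> {1..p}" and bh: "\<forall>j\<in>{1..p} - ?Th. bh \<omega> j = 0" by (auto simp: support_def)
    have \<omega>12: "\<omega> \<in> E1" "\<omega> \<in> E2" using \<omega> A(3) by auto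
    show "crit \<omega> (bh \<omega>) - crit \<omega> \<beta>\<^sub>0 \<le> (pred_norm n p regr (\<lambda>j. bh \<omega> j - \<beta>\<^sub>0 j))\<^sup>2
      + (4 * sqrt (tail_const (\<eta> / 2)) * \<sigma> * selection_rate (card (?Th - T\<^sub>0)) + 2 * c\<^sub>0)
        * pred_norm n p regr (\<lambda>j. bh \<omega> j - \<beta>\<^sub>0 j)"
      using E1(3)[THEN bspec, OF \<omega>12(1), THEN spec, THEN spec, THEN mp, OF Th, THEN mp, OF bh,
          THEN mp, OF A(4)[OF \<omega>]] by linarith
    show "crit \<omega> (vec_restrict ?Th \<beta>\<^sub>0) - crit \<omega> \<beta>\<^sub>0
      \<le> of_bool (\<not> T\<^sub>0 \<subseteq> ?Th) *
        ((pred_norm n p regr (vec_restrict ({1..p} - ?Th) \<beta>\<^sub>0))\<^sup>2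
         + (4 * sqrt (tail_const (\<eta> / 2)) * \<sigma> * omission_rate (card (T\<^sub>0 - ?Th)) + 2 * c\<^sub>0)
           * pred_norm n p regr (vec_restrict ({1..p} - ?Th) \<beta>\<^sub>0))"
    proof (cases "T\<^sub>0 \<subseteq> ?Th")
      \<comment> \<open>Nothing of \<open>\<beta>\<^sub>0\<close> is lost, so the predictions and
        the criterion agree and the gap is zero.\<close>
      case True
      then have "lin_pred p regr (vec_restrict ?Th \<beta>\<^sub>0) = lin_pred p regr \<beta>\<^sub>0"
        unfolding lin_pred_def by (intro ext sum.cong) (auto simp: vec_restrict_def support_def)
      then show ?thesis using True by (simp add: mean_sq_resid_def)
    next
      case False
      have "0 < kappa_tilde n p regr T\<^sub>0 0" by (rule kappa_tilde_antimono[OF A(4)[OF \<omega>]]) simp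
      from E2(3)[rule_format, OF \<omega>12(2) False this] False show ?thesis by simp
    qed
  qed
qed

end

text \<open>Each \<open>K\<close> is chosen before the probability space, the sample size, the
  dimension and all other data, so it depends on \<open>\<epsilon>\<close> only.\<close>

theorem theorem4:
  fixes \<epsilon> :: real
  assumes "0 < \<epsilon>"
  shows "(\<exists>K::real. \<forall>(M::'w measure) n p (z::nat \<Rightarrow> 'z) f P \<sigma> u \<beta>\<^sub>0 bh bt.
      let x = (\<lambda>i. P (z i)); fv = (\<lambda>i. f (z i)); y = (\<lambda>\<omega> i. f (z i) + u i \<omega>);
          Q = (\<lambda>\<omega>. mean_sq_resid n p x (y \<omega>));
          s = oracle_s n p x fv \<sigma>; c\<^sub>s = oracle_c n p x fv s; T = support p \<beta>\<^sub>0
      in gaussian_regression M n p z f P \<sigma> u \<beta>\<^sub>0 \<longrightarrow>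
         admissible_selector M n p x \<beta>\<^sub>0 bh \<longrightarrow>
         (AE \<omega> in M. post_selection_ls n p x (y \<omega>) (support p (bh \<omega>)) (bt \<omega>)) \<longrightarrow>
         (\<exists>A\<in>sets M. measure M A \<ge> 1 - \<epsilon> \<and> (\<forall>\<omega>\<in>A.
            let Th = support p (bh \<omega>); m = card (Th - T);
                B = Q \<omega> (bh \<omega>) - Q \<omega> \<beta>\<^sub>0;
                C = Q \<omega> (vec_restrict Th \<beta>\<^sub>0) - Q \<omega> \<beta>\<^sub>0
            in emp_norm n (\<lambda>i. lin_pred p x (bt \<omega>) i - fv i)
               \<le> K * \<sigma> * sqrt ((real m * ln (real p)
                                  + (real m + real s) * ln (exp 1 * mu n p x T m)) / real n)
                 + 3 * c\<^sub>s + sqrt (min (max B 0) (max C 0)))))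
    \<and> (\<exists>K::real. \<forall>(M::'w measure) n p (z::nat \<Rightarrow> 'z) f P \<sigma> u \<beta>\<^sub>0 bh.
      let x = (\<lambda>i. P (z i)); fv = (\<lambda>i. f (z i)); y = (\<lambda>\<omega> i. f (z i) + u i \<omega>);
          Q = (\<lambda>\<omega>. mean_sq_resid n p x (y \<omega>));
          s = oracle_s n p x fv \<sigma>; c\<^sub>s = oracle_c n p x fv s; T = support p \<beta>\<^sub>0
      in gaussian_regression M n p z f P \<sigma> u \<beta>\<^sub>0 \<longrightarrow>
         admissible_selector M n p x \<beta>\<^sub>0 bh \<longrightarrow>
         (\<exists>A\<in>sets M. measure M A \<ge> 1 - \<epsilon> \<and> (\<forall>\<omega>\<in>A.
            let Th = support p (bh \<omega>); m = card (Th - T); k = card (T - Th);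
                B = Q \<omega> (bh \<omega>) - Q \<omega> \<beta>\<^sub>0;
                C = Q \<omega> (vec_restrict Th \<beta>\<^sub>0) - Q \<omega> \<beta>\<^sub>0;
                d = pred_norm n p x (\<lambda>j. bh \<omega> j - \<beta>\<^sub>0 j);
                e = pred_norm n p x (vec_restrict ({1..p} - Th) \<beta>\<^sub>0)
            in B \<le> d\<^sup>2 + (K * \<sigma> * sqrt ((real m * ln (real p)
                                  + (real m + real s) * ln (exp 1 * mu n p x T m)) / real n)
                         + 2 * c\<^sub>s) * d
             \<and> C \<le> of_bool (\<not> T \<subseteq> Th) *
                   (e\<^sup>2 + (K * \<sigma> * sqrt ((ln (real (s choose k))
                                  + real k * ln (exp 1 * mu n p x T 0)) / real n)
                         + 2 * c\<^sub>s) * e))))"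
proof (intro conjI, goal_cases)
  case 1
  show ?case
    by (rule exI[of _ "4 * sqrt (tail_const \<epsilon>)"], unfold Let_def,
        intro allI impI gaussian_regression.post_selection_rate assms)
next
  case 2
  show ?case
    \<comment> \<open>The argument \<open>\<epsilon> / 2\<close> reflects the two events that are
      intersected.\<close>
    by (rule exI[of _ "4 * sqrt (tail_const (\<epsilon> / 2))"], unfold Let_def,
        intro allI impI gaussian_regression.selection_gaps assms)
qed

end
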